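(* Let $\mathcal{T}=\mathcal{T}_3(\mathcal{R}_i;\mathcal{M}_{ij})$ be a triangular 3-matrix ring. Assume that $Q_{i}\mathcal{Z}(\mathcal{T})Q_{i}=\mathcal{Z}(\mathcal{T}_{i})$ for $i=1,2,3$. Then each multiplicative Lie derivation $\varphi:\mathcal{T}\to\mathcal{T}$ has the form $$\varphi=\delta+\gamma,$$ where $\delta:\mathcal{T}\to\mathcal{T}$ is a derivation and $\gamma:\mathcal{T}\to\mathcal{Z}(\mathcal{T})$ is a center valued map such that $\gamma([x,y])=0$ for all $x,y\in\mathcal{T}$.
   Context: All rings are associative. For a ring $R$, $[x,y]=xy-yx$, and $\mathcal{Z}(R)=\{z\in R: [z,x]=0\ \forall x\in R\}$ is its center. A map $\varphi:R\to R$ (no additivity assumed) is a multiplicative Lie derivation if $\varphi([x,y])=[\varphi(x),y]+[x,\varphi(y)]$ for all $x,y\in R$. A derivation of $R$ is an additive map $\delta:R\to R$ with $\delta(xy)=\delta(x)y+x\delta(y)$ for all $x,y\in R$. The map $\gamma$ is not assumed additive. Triangular 3-matrix ring: let $\mathcal{R}_1,\mathcal{R}_2,\mathcal{R}_3$ be unital rings and, for $1\le i\le j\le 3$, let $\mathcal{M}_{ij}$ be a (unital) $(\mathcal{R}_i,\mathcal{R}_j)$-bimodule with $\mathcal{M}_{ii}=\mathcal{R}_i$. For $1\le i\le j\le k\le 3$ let $\varphi_{ijk}:\mathcal{M}_{ij}\otimes_{\mathcal{R}_j}\mathcal{M}_{jk}\to\mathcal{M}_{ik}$ be $(\mathcal{R}_i,\mathcal{R}_k)$-bimodule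 homomorphisms, where $\varphi_{iij}$ and $\varphi_{ijj}$ are the canonical multiplication maps; write $ab=\varphi_{ijk}(a\otimes b)$. Assume that for all $1\le i<j\le 3$, $\mathcal{M}_{ij}$ is faithful as a left $\mathcal{R}_i$-module ($a\mathcal{M}_{ij}=0$ implies $a=0$ for $a\in\mathcal{R}_i$) and faithful as a right $\mathcal{R}_j$-module ($\mathcal{M}_{ij}b=0$ implies $b=0$ for $b\in\mathcal{R}_j$). Then $\mathcal{T}=\mathcal{T}_3(\mathcal{R}_i;\mathcal{M}_{ij})$ is the ring, under the usual matrix operations, of all upper triangular matrices $$\begin{pmatrix} r_{11}&m_{12}&m_{13}\\ 0&r_{22}&m_{23}\\ 0&0&r_{33}\end{pmatrix},\qquad r_{ii}\in\mathcal{R}_i,\ m_{ij}\in\mathcal{M}_{ij}.$$ $Q_i\in\mathcal{T}$ ($i=1,2,3$) is the idempotent matrix with $1\in\mathcal{R}_i$ in position $(i,i)$ and $0$ elsewhere, and $\mathcal{T}_i=Q_i\mathcal{T}Q_i$ (a ring with unit $Q_i$, isomorphic to $\mathcal{R}_i$). *)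

theory Defs
  imports "HOL-Algebra.Free_Abelian_Groups" "HOL-Algebra.Module"
begin

section \<open>Lie brackets, centers and derivations\<close>

text \<open>A \<^term>\<open>ring R\<close> of HOL-Algebra is associative and unital, and may be the zero ring.\<close>

definition lie_bracket :: "('a, 'x) ring_scheme \<Rightarrow> 'a \<Rightarrow> 'a \<Rightarrow> 'a" where
  "lie_bracket R x y = (x \<otimes>\<^bsub>R\<^esub> y) \<ominus>\<^bsub>R\<^esub> (y \<otimes>\<^bsub>R\<^esub> x)"

definition ring_center :: "('a, 'x) ring_scheme \<Rightarrow> 'a set" where
  "ring_center R = {z \<in> carrier R. \<forall>x \<in> carrier R. lie_bracket R z x = \<zero>\<^bsub>R\<^esub>}"

definition mult_lie_derivation :: "('a, 'x) ring_scheme \<Rightarrow> ('a \<Rightarrow> 'a) \<Rightarrow> bool" where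
  "mult_lie_derivation R \<phi> \<longleftrightarrow>
     \<phi> \<in> carrier R \<rightarrow> carrier R \<and>
     (\<forall>x \<in> carrier R. \<forall>y \<in> carrier R.
        \<phi> (lie_bracket R x y) = lie_bracket R (\<phi> x) y \<oplus>\<^bsub>R\<^esub> lie_bracket R x (\<phi> y))"

definition ring_derivation :: "('a, 'x) ring_scheme \<Rightarrow> ('a \<Rightarrow> 'a) \<Rightarrow> bool" where
  "ring_derivation R \<delta> \<longleftrightarrow>
     \<delta> \<in> carrier R \<rightarrow> carrier R \<and>
     (\<forall>x \<in> carrier R. \<forall>y \<in> carrier R. \<delta> (x \<oplus>\<^bsub>R\<^esub> y) = \<delta> x \<oplus>\<^bsub>R\<^esub> \<delta> y) \<and>
     (\<forall>x \<in> carrier R. \<forall>y \<in> carrier R.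
        \<delta> (x \<otimes>\<^bsub>R\<^esub> y) = (\<delta> x \<otimes>\<^bsub>R\<^esub> y) \<oplus>\<^bsub>R\<^esub> (x \<otimes>\<^bsub>R\<^esub> \<delta> y))"

text \<open>For an idempotent \<open>e\<close>, the ring \<open>e R e\<close> with unit \<open>e\<close>.\<close>

definition corner_ring :: "'a ring \<Rightarrow> 'a \<Rightarrow> 'a ring" where
  "corner_ring R e = R \<lparr>carrier := (\<lambda>x. e \<otimes>\<^bsub>R\<^esub> x \<otimes>\<^bsub>R\<^esub> e) ` carrier R, one := e\<rparr>"

section \<open>Bimodules\<close>

text \<open>As for \<^typ>\<open>('a, 'b) module\<close>, the fields \<open>mult\<close> and \<open>one\<close> of the underlying ring record
  are not used.\<close>

record ('r, 's, 'm) bimodule = "'m ring" +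
  lact :: "'r \<Rightarrow> 'm \<Rightarrow> 'm"
  ract :: "'m \<Rightarrow> 's \<Rightarrow> 'm"

locale bimodule = R: ring R + S: ring S + M: abelian_group M
  for R :: "'r ring" and S :: "'s ring" and M :: "('r, 's, 'm) bimodule" +
  assumes lact_closed:
      "\<lbrakk>r \<in> carrier R; x \<in> carrier M\<rbrakk> \<Longrightarrow> lact M r x \<in> carrier M"
    and lact_add_left:
      "\<lbrakk>r \<in> carrier R; r' \<in> carrier R; x \<in> carrier M\<rbrakk> \<Longrightarrow>
        lact M (r \<oplus>\<^bsub>R\<^esub> r') x = lact M r x \<oplus>\<^bsub>M\<^esub> lact M r' x"
    and lact_add_right:
      "\<lbrakk>r \<in> carrier R; x \<in> carrier M; y \<in> carrier M\<rbrakk> \<Longrightarrow>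
        lact M r (x \<oplus>\<^bsub>M\<^esub> y) = lact M r x \<oplus>\<^bsub>M\<^esub> lact M r y"
    and lact_mult:
      "\<lbrakk>r \<in> carrier R; r' \<in> carrier R; x \<in> carrier M\<rbrakk> \<Longrightarrow>
        lact M (r \<otimes>\<^bsub>R\<^esub> r') x = lact M r (lact M r' x)"
    and lact_one: "x \<in> carrier M \<Longrightarrow> lact M \<one>\<^bsub>R\<^esub> x = x"
    and ract_closed:
      "\<lbrakk>x \<in> carrier M; s \<in> carrier S\<rbrakk> \<Longrightarrow> ract M x s \<in> carrier M"
    and ract_add_right:
      "\<lbrakk>x \<in> carrier M; s \<in> carrier S; s' \<in> carrier S\<rbrakk> \<Longrightarrow>
        ract M x (s \<oplus>\<^bsub>S\<^esub> s') = ract M x s \<oplus>\<^bsub>M\<^esub> ract M x s'"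
    and ract_add_left:
      "\<lbrakk>x \<in> carrier M; y \<in> carrier M; s \<in> carrier S\<rbrakk> \<Longrightarrow>
        ract M (x \<oplus>\<^bsub>M\<^esub> y) s = ract M x s \<oplus>\<^bsub>M\<^esub> ract M y s"
    and ract_mult:
      "\<lbrakk>x \<in> carrier M; s \<in> carrier S; s' \<in> carrier S\<rbrakk> \<Longrightarrow>
        ract M x (s \<otimes>\<^bsub>S\<^esub> s') = ract M (ract M x s) s'"
    and ract_one: "x \<in> carrier M \<Longrightarrow> ract M x \<one>\<^bsub>S\<^esub> = x"
    and lact_ract:
      "\<lbrakk>r \<in> carrier R; x \<in> carrier M; s \<in> carrier S\<rbrakk> \<Longrightarrow>
        ract M (lact M r x) s = lact M r (ract M x s)"

definition left_faithful :: "'r ring \<Rightarrow> ('r, 's, 'm) bimodule \<Rightarrow> bool" where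
  "left_faithful R M \<longleftrightarrow>
     (\<forall>a \<in> carrier R. (\<forall>x \<in> carrier M. lact M a x = \<zero>\<^bsub>M\<^esub>) \<longrightarrow> a = \<zero>\<^bsub>R\<^esub>)"

definition right_faithful :: "'s ring \<Rightarrow> ('r, 's, 'm) bimodule \<Rightarrow> bool" where
  "right_faithful S M \<longleftrightarrow>
     (\<forall>b \<in> carrier S. (\<forall>x \<in> carrier M. ract M x b = \<zero>\<^bsub>M\<^esub>) \<longrightarrow> b = \<zero>\<^bsub>S\<^esub>)"

definition bimodule_hom ::
    "'r ring \<Rightarrow> 's ring \<Rightarrow> ('r, 's, 'm) bimodule \<Rightarrow> ('r, 's, 'n) bimodule \<Rightarrow> ('m \<Rightarrow> 'n) set" where
  "bimodule_hom R S M N =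
     {h. h \<in> carrier M \<rightarrow> carrier N \<and>
         (\<forall>x \<in> carrier M. \<forall>y \<in> carrier M. h (x \<oplus>\<^bsub>M\<^esub> y) = h x \<oplus>\<^bsub>N\<^esub> h y) \<and>
         (\<forall>r \<in> carrier R. \<forall>x \<in> carrier M. h (lact M r x) = lact N r (h x)) \<and>
         (\<forall>x \<in> carrier M. \<forall>s \<in> carrier S. h (ract M x s) = ract N (h x) s)}"

section \<open>Tensor products of bimodules\<close>

text \<open>\<open>M \<otimes>\<^sub>S N\<close> is the free abelian group on \<open>M \<times> N\<close> modulo the subgroup generated by the
  biadditivity and balancedness relations.\<close>

definition tensor_free :: "('r, 's, 'm) bimodule \<Rightarrow> ('s, 't, 'n) bimodule \<Rightarrow> ('m \<times> 'n \<Rightarrow>\<^sub>0 int) monoid"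
  where "tensor_free M N = free_Abelian_group (carrier M \<times> carrier N)"

definition tensor_gens ::
    "'s ring \<Rightarrow> ('r, 's, 'm) bimodule \<Rightarrow> ('s, 't, 'n) bimodule \<Rightarrow> ('m \<times> 'n \<Rightarrow>\<^sub>0 int) set" where
  "tensor_gens S M N =
     {frag_of (x \<oplus>\<^bsub>M\<^esub> x', y) - frag_of (x, y) - frag_of (x', y) | x x' y.
        x \<in> carrier M \<and> x' \<in> carrier M \<and> y \<in> carrier N} \<union>
     {frag_of (x, y \<oplus>\<^bsub>N\<^esub> y') - frag_of (x, y) - frag_of (x, y') | x y y'.
        x \<in> carrier M \<and> y \<in> carrier N \<and> y' \<in> carrier N} \<union>
     {frag_of (ract M x s, y) - frag_of (x, lact N s y) | x s y.
        x \<in> carrier M \<and> s \<in> carrier S \<and> y \<in> carrier N}"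

definition tensor_rels ::
    "'s ring \<Rightarrow> ('r, 's, 'm) bimodule \<Rightarrow> ('s, 't, 'n) bimodule \<Rightarrow> ('m \<times> 'n \<Rightarrow>\<^sub>0 int) set" where
  "tensor_rels S M N = generate (tensor_free M N) (tensor_gens S M N)"

definition pure_tensor ::
    "'s ring \<Rightarrow> ('r, 's, 'm) bimodule \<Rightarrow> ('s, 't, 'n) bimodule \<Rightarrow> 'm \<Rightarrow> 'n \<Rightarrow> ('m \<times> 'n \<Rightarrow>\<^sub>0 int) set"
  where "pure_tensor S M N x y = tensor_rels S M N #>\<^bsub>tensor_free M N\<^esub> frag_of (x, y)"

text \<open>The actions are those induced by \<open>r (x \<otimes> y) = (r x) \<otimes> y\<close> and \<open>(x \<otimes> y) t = x \<otimes> (y t)\<close>.  On a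
  coset \<open>X\<close> they are given by applying the induced endomorphism of the free abelian group to the
  elements of \<open>X\<close>; adding the relations turns the image into a full coset again.\<close>

definition tensor_bimodule ::
    "'s ring \<Rightarrow> ('r, 's, 'm) bimodule \<Rightarrow> ('s, 't, 'n) bimodule \<Rightarrow>
     ('r, 't, ('m \<times> 'n \<Rightarrow>\<^sub>0 int) set) bimodule" where
  "tensor_bimodule S M N =
     \<lparr>carrier = carrier (tensor_free M N Mod tensor_rels S M N),
      mult = undefined,
      one = undefined,
      zero = \<one>\<^bsub>tensor_free M N Mod tensor_rels S M N\<^esub>,
      add = (\<lambda>X Y. X \<otimes>\<^bsub>tensor_free M N Mod tensor_rels S M N\<^esub> Y),
      lact = (\<lambda>r X. tensor_rels S M N <#>\<^bsub>tensor_free M N\<^esub>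
                frag_extend (\<lambda>(x, y). frag_of (lact M r x, y)) ` X),
      ract = (\<lambda>X t. tensor_rels S M N <#>\<^bsub>tensor_free M N\<^esub>
                frag_extend (\<lambda>(x, y). frag_of (x, ract N y t)) ` X)\<rparr>"

section \<open>Triangular 3-matrix rings\<close>

text \<open>The bimodule \<open>M\<^sub>i\<^sub>i\<close> is the ring \<open>R\<^sub>i\<close>, and the maps \<open>\<phi>\<^sub>i\<^sub>i\<^sub>j\<close>, \<open>\<phi>\<^sub>i\<^sub>j\<^sub>j\<close> are the canonical
  ones, i.e. the ring multiplications and the bimodule actions.  For size 3 the only remaining
  product map is \<open>f = \<phi>\<^sub>1\<^sub>2\<^sub>3\<close>.\<close>

locale triangular3 =
  R1: ring R1 + R2: ring R2 + R3: ring R3 +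
  M12: bimodule R1 R2 M12 + M13: bimodule R1 R3 M13 + M23: bimodule R2 R3 M23
  for R1 :: "'r1 ring" and R2 :: "'r2 ring" and R3 :: "'r3 ring"
    and M12 :: "('r1, 'r2, 'm12) bimodule"
    and M13 :: "('r1, 'r3, 'm13) bimodule"
    and M23 :: "('r2, 'r3, 'm23) bimodule"
    and f :: "('m12 \<times> 'm23 \<Rightarrow>\<^sub>0 int) set \<Rightarrow> 'm13" +
  assumes f_hom: "f \<in> bimodule_hom R1 R3 (tensor_bimodule R2 M12 M23) M13"
    and faithful12: "left_faithful R1 M12" "right_faithful R2 M12"
    and faithful13: "left_faithful R1 M13" "right_faithful R3 M13"
    and faithful23: "left_faithful R2 M23" "right_faithful R3 M23"

datatype ('r1, 'r2, 'r3, 'm12, 'm13, 'm23) tri =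
  Tri (e11: 'r1) (e12: 'm12) (e13: 'm13)
                 (e22: 'r2)  (e23: 'm23)
                             (e33: 'r3)

definition tri_ring ::
    "'r1 ring \<Rightarrow> 'r2 ring \<Rightarrow> 'r3 ring \<Rightarrow>
     ('r1, 'r2, 'm12) bimodule \<Rightarrow> ('r1, 'r3, 'm13) bimodule \<Rightarrow> ('r2, 'r3, 'm23) bimodule \<Rightarrow>
     (('m12 \<times> 'm23 \<Rightarrow>\<^sub>0 int) set \<Rightarrow> 'm13) \<Rightarrow>
     ('r1, 'r2, 'r3, 'm12, 'm13, 'm23) tri ring" where
  "tri_ring R1 R2 R3 M12 M13 M23 f =
     \<lparr>carrier = {A. e11 A \<in> carrier R1 \<and> e12 A \<in> carrier M12 \<and> e13 A \<in> carrier M13 \<and>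
                    e22 A \<in> carrier R2 \<and> e23 A \<in> carrier M23 \<and> e33 A \<in> carrier R3},
      mult = (\<lambda>A B. Tri
        (e11 A \<otimes>\<^bsub>R1\<^esub> e11 B)
        (lact M12 (e11 A) (e12 B) \<oplus>\<^bsub>M12\<^esub> ract M12 (e12 A) (e22 B))
        (lact M13 (e11 A) (e13 B) \<oplus>\<^bsub>M13\<^esub> f (pure_tensor R2 M12 M23 (e12 A) (e23 B))
           \<oplus>\<^bsub>M13\<^esub> ract M13 (e13 A) (e33 B))
        (e22 A \<otimes>\<^bsub>R2\<^esub> e22 B)
        (lact M23 (e22 A) (e23 B) \<oplus>\<^bsub>M23\<^esub> ract M23 (e23 A) (e33 B))
        (e33 A \<otimes>\<^bsub>R3\<^esub> e33 B)),
      one = Tri \<one>\<^bsub>R1\<^esub> \<zero>\<^bsub>M12\<^esub> \<zero>\<^bsub>M13\<^esub> \<one>\<^bsub>R2\<^esub> \<zero>\<^bsub>M23\<^esub> \<one>\<^bsub>R3\<^esub>,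
      zero = Tri \<zero>\<^bsub>R1\<^esub> \<zero>\<^bsub>M12\<^esub> \<zero>\<^bsub>M13\<^esub> \<zero>\<^bsub>R2\<^esub> \<zero>\<^bsub>M23\<^esub> \<zero>\<^bsub>R3\<^esub>,
      add = (\<lambda>A B. Tri
        (e11 A \<oplus>\<^bsub>R1\<^esub> e11 B) (e12 A \<oplus>\<^bsub>M12\<^esub> e12 B) (e13 A \<oplus>\<^bsub>M13\<^esub> e13 B)
        (e22 A \<oplus>\<^bsub>R2\<^esub> e22 B) (e23 A \<oplus>\<^bsub>M23\<^esub> e23 B)
        (e33 A \<oplus>\<^bsub>R3\<^esub> e33 B))\<rparr>"

definition tri_idem ::
    "'r1 ring \<Rightarrow> 'r2 ring \<Rightarrow> 'r3 ring \<Rightarrow>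
     ('r1, 'r2, 'm12) bimodule \<Rightarrow> ('r1, 'r3, 'm13) bimodule \<Rightarrow> ('r2, 'r3, 'm23) bimodule \<Rightarrow>
     nat \<Rightarrow> ('r1, 'r2, 'r3, 'm12, 'm13, 'm23) tri" where
  "tri_idem R1 R2 R3 M12 M13 M23 i =
     Tri (if i = 1 then \<one>\<^bsub>R1\<^esub> else \<zero>\<^bsub>R1\<^esub>) \<zero>\<^bsub>M12\<^esub> \<zero>\<^bsub>M13\<^esub>
         (if i = 2 then \<one>\<^bsub>R2\<^esub> else \<zero>\<^bsub>R2\<^esub>) \<zero>\<^bsub>M23\<^esub>
         (if i = 3 then \<one>\<^bsub>R3\<^esub> else \<zero>\<^bsub>R3\<^esub>)"

section \<open>The tensor product is a bimodule, and the matrices form a ring\<close>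

locale tensor_pair = M: bimodule R S M + N: bimodule S U N
  for R :: "'r ring" and S :: "'s ring" and U :: "'t ring"
    and M :: "('r, 's, 'm) bimodule" and N :: "('s, 't, 'n) bimodule"
begin

abbreviation "F \<equiv> tensor_free M N"
abbreviation "K \<equiv> tensor_rels S M N"

lemma in_F: "c \<in> carrier F \<longleftrightarrow> Poly_Mapping.keys c \<subseteq> carrier M \<times> carrier N"
  by (simp add: tensor_free_def)

lemma group_F: "comm_group F"
  by (simp add: tensor_free_def abelian_free_Abelian_group)

lemma mult_F: "a \<otimes>\<^bsub>F\<^esub> b = a + b"
  by (simp add: tensor_free_def)

lemma F_diff: "a \<in> carrier F \<Longrightarrow> b \<in> carrier F \<Longrightarrow> a - b \<in> carrier F"
  unfolding in_F by (rule order_trans[OF keys_diff Un_least])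

lemma F_add: "a \<in> carrier F \<Longrightarrow> b \<in> carrier F \<Longrightarrow> a + b \<in> carrier F"
  unfolding in_F by (rule order_trans[OF keys_add Un_least])

lemma F_frag: "x \<in> carrier M \<Longrightarrow> y \<in> carrier N \<Longrightarrow> frag_of (x, y) \<in> carrier F"
  by (simp add: in_F)

lemma gens_F: "tensor_gens S M N \<subseteq> carrier F"
  unfolding tensor_gens_def
  by (auto intro!: F_diff F_frag M.ract_closed N.lact_closed M.M.add.m_closed N.M.add.m_closed)

lemma subgroup_K: "subgroup K F"
  unfolding tensor_rels_def
  by (intro group.generate_is_subgroup gens_F comm_group.axioms(2) group_F)

lemma K_F: "K \<subseteq> carrier F"
  by (rule subgroup.subset[OF subgroup_K])

lemma K_add: "a \<in> K \<Longrightarrow> b \<in> K \<Longrightarrow> a + b \<in> K"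
  using subgroup.m_closed[OF subgroup_K] by (simp add: mult_F)

lemma K_zero: "0 \<in> K"
  using subgroup.one_closed[OF subgroup_K] by (simp add: tensor_free_def)

lemma K_minus: "a \<in> K \<Longrightarrow> - a \<in> K"
  using subgroup.m_inv_closed[OF subgroup_K, of a] K_F
  by (auto simp: tensor_free_def)

lemma K_diff: "a \<in> K \<Longrightarrow> b \<in> K \<Longrightarrow> a - b \<in> K"
  using K_add[of a "- b"] K_minus[of b] by simp

lemma K_gens: "a \<in> tensor_gens S M N \<Longrightarrow> a \<in> K"
  by (simp add: tensor_rels_def generate.incl)

definition tcoset where "tcoset a = K #>\<^bsub>F\<^esub> a"

lemma tcoset_set: "tcoset a = {k + a | k. k \<in> K}"
  by (auto simp: tcoset_def r_coset_def mult_F)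

lemma tcoset_eq: assumes "a - b \<in> K" shows "tcoset a = tcoset b"
proof -
  have "\<exists>k'\<in>K. k + a = k' + b" if "k \<in> K" for k
    using K_add[OF that assms] by (intro bexI[of _ "k + (a - b)"]) auto
  moreover have "\<exists>k'\<in>K. k + b = k' + a" if "k \<in> K" for k
    using K_diff[OF that assms] by (intro bexI[of _ "k - (a - b)"]) auto
  ultimately show ?thesis unfolding tcoset_set by blast
qed

lemma tcoset_add: "tcoset a <#>\<^bsub>F\<^esub> tcoset b = tcoset (a + b)"
proof (intro equalityI subsetI)
  fix z assume "z \<in> tcoset a <#>\<^bsub>F\<^esub> tcoset b"
  then obtain k k' where "k \<in> K" "k' \<in> K" "z = (k + a) + (k' + b)"
    by (auto simp: set_mult_def mult_F tcoset_set)
  then show "z \<in> tcoset (a + b)"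
    unfolding tcoset_set by (intro CollectI exI[of _ "k + k'"]) (simp add: K_add algebra_simps)
next
  fix z assume "z \<in> tcoset (a + b)"
  then obtain k where k: "k \<in> K" "z = (k + a) + b" by (auto simp: tcoset_set algebra_simps)
  have "k + a \<in> tcoset a" "b \<in> tcoset b"
    using k(1) K_zero unfolding tcoset_set by force+
  then show "z \<in> tcoset a <#>\<^bsub>F\<^esub> tcoset b"
    unfolding set_mult_def mult_F k(2) by blast
qed

abbreviation "T \<equiv> tensor_bimodule S M N"

lemma carrier_T: "carrier T = tcoset ` carrier F"
  by (simp add: tensor_bimodule_def carrier_FactGroup tcoset_def)

lemma add_T: "tcoset a \<oplus>\<^bsub>T\<^esub> tcoset b = tcoset (a + b)"
  by (simp add: tensor_bimodule_def tcoset_add)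

lemma zero_T: "\<zero>\<^bsub>T\<^esub> = tcoset 0"
  by (simp add: tensor_bimodule_def tcoset_set)

lemma pure: "pure_tensor S M N x y = tcoset (frag_of (x, y))"
  by (simp add: pure_tensor_def tcoset_def)

definition "lext r = frag_extend (\<lambda>(x, y). frag_of (lact M r x, y))"
definition "rext t = frag_extend (\<lambda>(x, y). frag_of (x, ract N y t))"

lemma lext_simps: "lext r 0 = 0" "lext r (a + b) = lext r a + lext r b"
  "lext r (- a) = - lext r a" "lext r (a - b) = lext r a - lext r b"
  "lext r (frag_of (x, y)) = frag_of (lact M r x, y)"
  by (simp_all add: lext_def frag_extend_add frag_extend_diff frag_extend_minus)

lemma rext_simps: "rext t 0 = 0" "rext t (a + b) = rext t a + rext t b"
  "rext t (- a) = - rext t a" "rext t (a - b) = rext t a - rext t b"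
  "rext t (frag_of (x, y)) = frag_of (x, ract N y t)"
  by (simp_all add: rext_def frag_extend_add frag_extend_diff frag_extend_minus)

lemma F_induct [consumes 1, case_names zero one diff]:
  assumes "c \<in> carrier F" "P 0"
    "\<And>x y. x \<in> carrier M \<Longrightarrow> y \<in> carrier N \<Longrightarrow> P (frag_of (x, y))"
    "\<And>a b. P a \<Longrightarrow> P b \<Longrightarrow> P (a - b)"
  shows "P c"
  using assms(1) unfolding in_F
  by (rule frag_induction) (use assms in auto)

lemma F_zero: "0 \<in> carrier F"
  by (simp add: in_F)

lemma lext_F:
  assumes "c \<in> carrier F" "r \<in> carrier R" shows "lext r c \<in> carrier F"
  using assms(1) by (induction c rule: F_induct)
    (simp_all add: lext_simps F_zero F_diff M.lact_closed F_frag assms(2))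

lemma rext_F:
  assumes "c \<in> carrier F" "t \<in> carrier U" shows "rext t c \<in> carrier F"
  using assms(1) by (induction c rule: F_induct)
    (simp_all add: rext_simps F_zero F_diff N.ract_closed F_frag assms(2))

lemma K_induct [consumes 1, case_names zero gen minus add]:
  assumes "c \<in> K" "P 0" "\<And>g. g \<in> tensor_gens S M N \<Longrightarrow> P g"
    "\<And>a. P a \<Longrightarrow> P (- a)" "\<And>a b. P a \<Longrightarrow> P b \<Longrightarrow> P (a + b)"
  shows "P c"
  using assms(1) unfolding tensor_rels_def
proof (induction rule: generate.induct)
  case one then show ?case using assms(2) by (simp add: tensor_free_def)
next
  case (incl h) then show ?case using assms(3) by simp
next
  case (inv h)
  then have "Poly_Mapping.keys h \<subseteq> carrier M \<times> carrier N" using gens_F in_F by blast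
  then have "inv\<^bsub>F\<^esub> h = - h" by (simp add: tensor_free_def)
  then show ?case using inv assms(3,4) by simp
next
  case (eng a b) then show ?case using assms(5) by (simp add: mult_F)
qed

lemma lext_gens: assumes r: "r \<in> carrier R" and c: "c \<in> tensor_gens S M N"
  shows "lext r c \<in> tensor_gens S M N"
proof -
  consider (1) x x' y where "c = frag_of (x \<oplus>\<^bsub>M\<^esub> x', y) - frag_of (x, y) - frag_of (x', y)"
      "x \<in> carrier M" "x' \<in> carrier M" "y \<in> carrier N"
    | (2) x y y' where "c = frag_of (x, y \<oplus>\<^bsub>N\<^esub> y') - frag_of (x, y) - frag_of (x, y')"
      "x \<in> carrier M" "y \<in> carrier N" "y' \<in> carrier N"
    | (3) x s y where "c = frag_of (ract M x s, y) - frag_of (x, lact N s y)"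
      "x \<in> carrier M" "s \<in> carrier S" "y \<in> carrier N"
    using c unfolding tensor_gens_def by blast
  then show ?thesis
  proof cases
    case 1 then show ?thesis unfolding tensor_gens_def
      by (intro UnI1 CollectI exI[of _ "lact M r x"] exI[of _ "lact M r x'"] exI[of _ y])
         (simp add: lext_simps M.lact_add_right M.lact_closed r)
  next
    case 2 then show ?thesis unfolding tensor_gens_def
      by (intro UnI1 UnI2 CollectI exI[of _ "lact M r x"] exI[of _ y] exI[of _ y'])
         (simp add: lext_simps M.lact_closed r)
  next
    case 3 then show ?thesis unfolding tensor_gens_def
      by (intro UnI2 CollectI exI[of _ "lact M r x"] exI[of _ s] exI[of _ y])
         (simp add: lext_simps M.lact_closed M.lact_ract r)
  qed
qed

lemma rext_gens: assumes t: "t \<in> carrier U" and c: "c \<in> tensor_gens S M N"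
  shows "rext t c \<in> tensor_gens S M N"
proof -
  consider (1) x x' y where "c = frag_of (x \<oplus>\<^bsub>M\<^esub> x', y) - frag_of (x, y) - frag_of (x', y)"
      "x \<in> carrier M" "x' \<in> carrier M" "y \<in> carrier N"
    | (2) x y y' where "c = frag_of (x, y \<oplus>\<^bsub>N\<^esub> y') - frag_of (x, y) - frag_of (x, y')"
      "x \<in> carrier M" "y \<in> carrier N" "y' \<in> carrier N"
    | (3) x s y where "c = frag_of (ract M x s, y) - frag_of (x, lact N s y)"
      "x \<in> carrier M" "s \<in> carrier S" "y \<in> carrier N"
    using c unfolding tensor_gens_def by blast
  then show ?thesis
  proof cases
    case 1 then show ?thesis unfolding tensor_gens_def
      by (intro UnI1 CollectI exI[of _ x] exI[of _ x'] exI[of _ "ract N y t"])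
         (simp add: rext_simps N.ract_closed t)
  next
    case 2 then show ?thesis unfolding tensor_gens_def
      by (intro UnI1 UnI2 CollectI exI[of _ x] exI[of _ "ract N y t"] exI[of _ "ract N y' t"])
         (simp add: rext_simps N.ract_closed N.ract_add_left t)
  next
    case 3 then show ?thesis unfolding tensor_gens_def
      by (intro UnI2 CollectI exI[of _ x] exI[of _ s] exI[of _ "ract N y t"])
         (simp add: rext_simps N.ract_closed N.lact_ract t)
  qed
qed

lemma lext_K: "c \<in> K \<Longrightarrow> r \<in> carrier R \<Longrightarrow> lext r c \<in> K"
  by (induction c rule: K_induct)
     (auto simp: lext_simps K_zero K_minus K_add intro: K_gens lext_gens)

lemma rext_K: "c \<in> K \<Longrightarrow> t \<in> carrier U \<Longrightarrow> rext t c \<in> K"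
  by (induction c rule: K_induct)
     (auto simp: rext_simps K_zero K_minus K_add intro: K_gens rext_gens)

lemma tcoset_image:
  assumes "\<And>k. k \<in> K \<Longrightarrow> h k \<in> K" "\<And>a b. h (a + b) = h a + h b"
  shows "K <#>\<^bsub>F\<^esub> h ` tcoset a = tcoset (h a)"
proof (intro equalityI subsetI)
  fix z assume "z \<in> K <#>\<^bsub>F\<^esub> h ` tcoset a"
  then obtain k k' where "k \<in> K" "k' \<in> K" "z = k + h (k' + a)"
    by (auto simp: set_mult_def mult_F tcoset_set)
  then show "z \<in> tcoset (h a)"
    unfolding tcoset_set
    by (intro CollectI exI[of _ "k + h k'"]) (simp add: assms K_add add.assoc)
next
  fix z assume "z \<in> tcoset (h a)"
  then obtain k where "k \<in> K" "z = k + h a" by (auto simp: tcoset_set)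
  moreover have "a \<in> tcoset a" using K_zero by (auto simp: tcoset_set)
  ultimately show "z \<in> K <#>\<^bsub>F\<^esub> h ` tcoset a"
    by (auto simp: set_mult_def mult_F)
qed

lemma lact_T: "r \<in> carrier R \<Longrightarrow> lact T r (tcoset a) = tcoset (lext r a)"
  using tcoset_image[of "lext r" a] lext_K by (simp add: tensor_bimodule_def lext_simps flip: lext_def)

lemma ract_T: "t \<in> carrier U \<Longrightarrow> ract T (tcoset a) t = tcoset (rext t a)"
  using tcoset_image[of "rext t" a] rext_K by (simp add: tensor_bimodule_def rext_simps flip: rext_def)

lemma pure_tensor_closed:
  "x \<in> carrier M \<Longrightarrow> y \<in> carrier N \<Longrightarrow> pure_tensor S M N x y \<in> carrier T"
  by (simp add: pure carrier_T F_frag)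

lemma pure_tensor_add_left:
  assumes "x \<in> carrier M" "x' \<in> carrier M" "y \<in> carrier N"
  shows "pure_tensor S M N (x \<oplus>\<^bsub>M\<^esub> x') y = pure_tensor S M N x y \<oplus>\<^bsub>T\<^esub> pure_tensor S M N x' y"
  unfolding pure add_T
  by (rule tcoset_eq, unfold diff_diff_eq[symmetric], rule K_gens)
     (use assms in \<open>unfold tensor_gens_def, blast\<close>)

lemma pure_tensor_add_right:
  assumes "x \<in> carrier M" "y \<in> carrier N" "y' \<in> carrier N"
  shows "pure_tensor S M N x (y \<oplus>\<^bsub>N\<^esub> y') = pure_tensor S M N x y \<oplus>\<^bsub>T\<^esub> pure_tensor S M N x y'"
  unfolding pure add_T
  by (rule tcoset_eq, unfold diff_diff_eq[symmetric], rule K_gens)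
     (use assms in \<open>unfold tensor_gens_def, blast\<close>)

lemma pure_tensor_balanced:
  assumes "x \<in> carrier M" "s \<in> carrier S" "y \<in> carrier N"
  shows "pure_tensor S M N (ract M x s) y = pure_tensor S M N x (lact N s y)"
  unfolding pure
  by (rule tcoset_eq, rule K_gens) (use assms in \<open>unfold tensor_gens_def, blast\<close>)

lemma lact_pure_tensor:
  "r \<in> carrier R \<Longrightarrow> lact T r (pure_tensor S M N x y) = pure_tensor S M N (lact M r x) y"
  by (simp add: pure lact_T lext_simps)

lemma ract_pure_tensor:
  "t \<in> carrier U \<Longrightarrow> ract T (pure_tensor S M N x y) t = pure_tensor S M N x (ract N y t)"
  by (simp add: pure ract_T rext_simps)

lemma abelian_group_T: "abelian_group T"
proof (rule abelian_groupI)
  show "\<zero>\<^bsub>T\<^esub> \<in> carrier T"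
    unfolding zero_T carrier_T by (rule imageI) (simp add: in_F)
  fix x assume "x \<in> carrier T"
  then obtain a where a: "x = tcoset a" "a \<in> carrier F" by (auto simp: carrier_T)
  show "\<zero>\<^bsub>T\<^esub> \<oplus>\<^bsub>T\<^esub> x = x" by (simp add: a zero_T add_T)
  show "\<exists>y\<in>carrier T. y \<oplus>\<^bsub>T\<^esub> x = \<zero>\<^bsub>T\<^esub>"
    using a by (intro bexI[of _ "tcoset (- a)"]) (auto simp: zero_T add_T carrier_T in_F)
qed (auto simp: carrier_T add_T F_add ac_simps)

lemma bimodule_T: "bimodule R U T"
proof -
  interpret T: abelian_group T by (rule abelian_group_T)
  show ?thesis
  proof (unfold_locales, goal_cases)
    case (1 r x) then show ?case by (auto simp: carrier_T lact_T lext_F)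
  next
    case (2 r r' x)
    then obtain a where a: "x = tcoset a" "a \<in> carrier F" by (auto simp: carrier_T)
    from a(2) have "lext (r \<oplus>\<^bsub>R\<^esub> r') a - (lext r a + lext r' a) \<in> K"
    proof (induction a rule: F_induct)
      case zero then show ?case by (simp add: lext_simps K_zero)
    next
      case (one x y)
      have "frag_of (lact M r x \<oplus>\<^bsub>M\<^esub> lact M r' x, y) - frag_of (lact M r x, y) - frag_of (lact M r' x, y)
        \<in> tensor_gens S M N"
        unfolding tensor_gens_def using one 2 by (blast intro: M.lact_closed)
      then show ?case using one 2
        by (simp add: lext_simps M.lact_add_left diff_diff_eq K_gens)
    next
      case (diff a b)
      from K_diff[OF this] show ?case by (simp add: lext_simps algebra_simps)
    qed
    then show ?case using 2 a by (simp add: lact_T add_T tcoset_eq)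
  next
    case (3 r x y) then show ?case by (auto simp: carrier_T lact_T add_T lext_simps)
  next
    case (4 r r' x)
    then obtain a where a: "x = tcoset a" "a \<in> carrier F" by (auto simp: carrier_T)
    from a(2) have "lext (r \<otimes>\<^bsub>R\<^esub> r') a = lext r (lext r' a)"
      by (induction a rule: F_induct) (use 4 in \<open>auto simp: lext_simps M.lact_mult\<close>)
    then show ?case using 4 a by (simp add: lact_T)
  next
    case (5 x)
    then obtain a where a: "x = tcoset a" "a \<in> carrier F" by (auto simp: carrier_T)
    from a(2) have "lext \<one>\<^bsub>R\<^esub> a = a"
      by (induction a rule: F_induct) (auto simp: lext_simps M.lact_one)
    then show ?case using a by (simp add: lact_T)
  next
    case (6 x t) then show ?case by (auto simp: carrier_T ract_T rext_F)
  next
    case (7 x r r')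
    then obtain a where a: "x = tcoset a" "a \<in> carrier F" by (auto simp: carrier_T)
    from a(2) have "rext (r \<oplus>\<^bsub>U\<^esub> r') a - (rext r a + rext r' a) \<in> K"
    proof (induction a rule: F_induct)
      case zero then show ?case by (simp add: rext_simps K_zero)
    next
      case (one x y)
      have "frag_of (x, ract N y r \<oplus>\<^bsub>N\<^esub> ract N y r') - frag_of (x, ract N y r) - frag_of (x, ract N y r')
        \<in> tensor_gens S M N"
        unfolding tensor_gens_def using one 7 by (blast intro: N.ract_closed)
      then show ?case using one 7
        by (simp add: rext_simps N.ract_add_right diff_diff_eq K_gens)
    next
      case (diff a b)
      from K_diff[OF this] show ?case by (simp add: rext_simps algebra_simps)
    qed
    then show ?case using 7 a by (simp add: ract_T add_T tcoset_eq)
  next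
    case (8 x y t) then show ?case by (auto simp: carrier_T ract_T add_T rext_simps)
  next
    case (9 x s s')
    then obtain a where a: "x = tcoset a" "a \<in> carrier F" by (auto simp: carrier_T)
    from a(2) have "rext (s \<otimes>\<^bsub>U\<^esub> s') a = rext s' (rext s a)"
      by (induction a rule: F_induct) (use 9 in \<open>auto simp: rext_simps N.ract_mult\<close>)
    then show ?case using 9 a by (simp add: ract_T)
  next
    case (10 x)
    then obtain a where a: "x = tcoset a" "a \<in> carrier F" by (auto simp: carrier_T)
    from a(2) have "rext \<one>\<^bsub>U\<^esub> a = a"
      by (induction a rule: F_induct) (auto simp: rext_simps N.ract_one)
    then show ?case using a by (simp add: ract_T)
  next
    case (11 r x s)
    then obtain a where a: "x = tcoset a" "a \<in> carrier F" by (auto simp: carrier_T)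
    from a(2) have "rext s (lext r a) = lext r (rext s a)"
      by (induction a rule: F_induct) (auto simp: rext_simps lext_simps)
    then show ?case using 11 a by (simp add: ract_T lact_T)
  qed
qed

end

context triangular3
begin

sublocale P: tensor_pair R1 R2 R3 M12 M23 ..

definition prod123 where "prod123 x y = f (pure_tensor R2 M12 M23 x y)"

lemma prod123:
  "x \<in> carrier M12 \<Longrightarrow> y \<in> carrier M23 \<Longrightarrow> prod123 x y \<in> carrier M13"
  "\<lbrakk>x \<in> carrier M12; x' \<in> carrier M12; y \<in> carrier M23\<rbrakk> \<Longrightarrow>
     prod123 (x \<oplus>\<^bsub>M12\<^esub> x') y = prod123 x y \<oplus>\<^bsub>M13\<^esub> prod123 x' y"
  "\<lbrakk>x \<in> carrier M12; y \<in> carrier M23; y' \<in> carrier M23\<rbrakk> \<Longrightarrow>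
     prod123 x (y \<oplus>\<^bsub>M23\<^esub> y') = prod123 x y \<oplus>\<^bsub>M13\<^esub> prod123 x y'"
  "\<lbrakk>x \<in> carrier M12; s \<in> carrier R2; y \<in> carrier M23\<rbrakk> \<Longrightarrow>
     prod123 (ract M12 x s) y = prod123 x (lact M23 s y)"
  "\<lbrakk>r \<in> carrier R1; x \<in> carrier M12; y \<in> carrier M23\<rbrakk> \<Longrightarrow>
     prod123 (lact M12 r x) y = lact M13 r (prod123 x y)"
  "\<lbrakk>x \<in> carrier M12; y \<in> carrier M23; t \<in> carrier R3\<rbrakk> \<Longrightarrow>
     prod123 x (ract M23 y t) = ract M13 (prod123 x y) t"
proof -
  note h = f_hom[unfolded bimodule_hom_def]
  note c = P.pure_tensor_closed
  show "x \<in> carrier M12 \<Longrightarrow> y \<in> carrier M23 \<Longrightarrow> prod123 x y \<in> carrier M13"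
    using h c by (auto simp: prod123_def)
  show "\<lbrakk>x \<in> carrier M12; x' \<in> carrier M12; y \<in> carrier M23\<rbrakk> \<Longrightarrow>
     prod123 (x \<oplus>\<^bsub>M12\<^esub> x') y = prod123 x y \<oplus>\<^bsub>M13\<^esub> prod123 x' y"
    using h c by (auto simp: prod123_def P.pure_tensor_add_left)
  show "\<lbrakk>x \<in> carrier M12; y \<in> carrier M23; y' \<in> carrier M23\<rbrakk> \<Longrightarrow>
     prod123 x (y \<oplus>\<^bsub>M23\<^esub> y') = prod123 x y \<oplus>\<^bsub>M13\<^esub> prod123 x y'"
    using h c by (auto simp: prod123_def P.pure_tensor_add_right)
  show "\<lbrakk>x \<in> carrier M12; s \<in> carrier R2; y \<in> carrier M23\<rbrakk> \<Longrightarrow>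
     prod123 (ract M12 x s) y = prod123 x (lact M23 s y)"
    by (auto simp: prod123_def P.pure_tensor_balanced)
  show "\<lbrakk>r \<in> carrier R1; x \<in> carrier M12; y \<in> carrier M23\<rbrakk> \<Longrightarrow>
     prod123 (lact M12 r x) y = lact M13 r (prod123 x y)"
    using h c by (auto simp: prod123_def simp flip: P.lact_pure_tensor)
  show "\<lbrakk>x \<in> carrier M12; y \<in> carrier M23; t \<in> carrier R3\<rbrakk> \<Longrightarrow>
     prod123 x (ract M23 y t) = ract M13 (prod123 x y) t"
    using h c by (auto simp: prod123_def simp flip: P.ract_pure_tensor)
qed

end

context bimodule
begin

lemma lact_zero_left: "x \<in> carrier M \<Longrightarrow> lact M \<zero>\<^bsub>R\<^esub> x = \<zero>\<^bsub>M\<^esub>"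
  using lact_add_left[of "\<zero>\<^bsub>R\<^esub>" "\<zero>\<^bsub>R\<^esub>" x] lact_closed[of "\<zero>\<^bsub>R\<^esub>" x] by simp

lemma lact_zero_right: "r \<in> carrier R \<Longrightarrow> lact M r \<zero>\<^bsub>M\<^esub> = \<zero>\<^bsub>M\<^esub>"
  using lact_add_right[of r "\<zero>\<^bsub>M\<^esub>" "\<zero>\<^bsub>M\<^esub>"] lact_closed[of r "\<zero>\<^bsub>M\<^esub>"] by simp

lemma ract_zero_right: "x \<in> carrier M \<Longrightarrow> ract M x \<zero>\<^bsub>S\<^esub> = \<zero>\<^bsub>M\<^esub>"
  using ract_add_right[of x "\<zero>\<^bsub>S\<^esub>" "\<zero>\<^bsub>S\<^esub>"] ract_closed[of x "\<zero>\<^bsub>S\<^esub>"] by simp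

lemma ract_zero_left: "s \<in> carrier S \<Longrightarrow> ract M \<zero>\<^bsub>M\<^esub> s = \<zero>\<^bsub>M\<^esub>"
  using ract_add_left[of "\<zero>\<^bsub>M\<^esub>" "\<zero>\<^bsub>M\<^esub>" s] ract_closed[of "\<zero>\<^bsub>M\<^esub>" s] by simp

lemmas zeros = lact_zero_left lact_zero_right ract_zero_left ract_zero_right
lemmas closed = lact_closed ract_closed
lemmas acts = lact_add_left lact_add_right ract_add_left ract_add_right
  lact_mult ract_mult lact_one ract_one lact_ract

end

context triangular3
begin

lemma prod123_zero:
  "y \<in> carrier M23 \<Longrightarrow> prod123 \<zero>\<^bsub>M12\<^esub> y = \<zero>\<^bsub>M13\<^esub>"
  "x \<in> carrier M12 \<Longrightarrow> prod123 x \<zero>\<^bsub>M23\<^esub> = \<zero>\<^bsub>M13\<^esub>"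
  using prod123(2)[of "\<zero>\<^bsub>M12\<^esub>" "\<zero>\<^bsub>M12\<^esub>" y] prod123(1)[of "\<zero>\<^bsub>M12\<^esub>" y]
    prod123(3)[of x "\<zero>\<^bsub>M23\<^esub>" "\<zero>\<^bsub>M23\<^esub>"] prod123(1)[of x "\<zero>\<^bsub>M23\<^esub>"]
  by simp_all

lemma tri_carrier: "Tri a x z b y c \<in> carrier (tri_ring R1 R2 R3 M12 M13 M23 f) \<longleftrightarrow>
    a \<in> carrier R1 \<and> x \<in> carrier M12 \<and> z \<in> carrier M13 \<and>
    b \<in> carrier R2 \<and> y \<in> carrier M23 \<and> c \<in> carrier R3"
  by (simp add: tri_ring_def)

lemma tri_mult: "Tri a x z b y c \<otimes>\<^bsub>tri_ring R1 R2 R3 M12 M13 M23 f\<^esub> Tri a' x' z' b' y' c' =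
    Tri (a \<otimes>\<^bsub>R1\<^esub> a') (lact M12 a x' \<oplus>\<^bsub>M12\<^esub> ract M12 x b')
      (lact M13 a z' \<oplus>\<^bsub>M13\<^esub> prod123 x y' \<oplus>\<^bsub>M13\<^esub> ract M13 z c')
      (b \<otimes>\<^bsub>R2\<^esub> b') (lact M23 b y' \<oplus>\<^bsub>M23\<^esub> ract M23 y c') (c \<otimes>\<^bsub>R3\<^esub> c')"
  by (simp add: tri_ring_def prod123_def)

lemma tri_add: "Tri a x z b y c \<oplus>\<^bsub>tri_ring R1 R2 R3 M12 M13 M23 f\<^esub> Tri a' x' z' b' y' c' =
    Tri (a \<oplus>\<^bsub>R1\<^esub> a') (x \<oplus>\<^bsub>M12\<^esub> x') (z \<oplus>\<^bsub>M13\<^esub> z') (b \<oplus>\<^bsub>R2\<^esub> b') (y \<oplus>\<^bsub>M23\<^esub> y') (c \<oplus>\<^bsub>R3\<^esub> c')"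
  by (simp add: tri_ring_def)

lemma tri_zero: "\<zero>\<^bsub>tri_ring R1 R2 R3 M12 M13 M23 f\<^esub> =
    Tri \<zero>\<^bsub>R1\<^esub> \<zero>\<^bsub>M12\<^esub> \<zero>\<^bsub>M13\<^esub> \<zero>\<^bsub>R2\<^esub> \<zero>\<^bsub>M23\<^esub> \<zero>\<^bsub>R3\<^esub>"
  by (simp add: tri_ring_def)

lemma tri_one: "\<one>\<^bsub>tri_ring R1 R2 R3 M12 M13 M23 f\<^esub> =
    Tri \<one>\<^bsub>R1\<^esub> \<zero>\<^bsub>M12\<^esub> \<zero>\<^bsub>M13\<^esub> \<one>\<^bsub>R2\<^esub> \<zero>\<^bsub>M23\<^esub> \<one>\<^bsub>R3\<^esub>"
  by (simp add: tri_ring_def)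

theorem ring_tri_ring: "ring (tri_ring R1 R2 R3 M12 M13 M23 f)"
proof (rule ringI)
  let ?T = "tri_ring R1 R2 R3 M12 M13 M23 f"
  note tri = tri_carrier tri_mult tri_add tri_zero tri_one
  note cl = M12.closed M13.closed M23.closed prod123(1)
  note zr = M12.zeros M13.zeros M23.zeros prod123_zero
  note ac = M12.acts M13.acts M23.acts prod123(2-)
  show "abelian_group ?T"
  proof (rule abelian_groupI)
    show "x \<oplus>\<^bsub>?T\<^esub> y \<in> carrier ?T" if "x \<in> carrier ?T" "y \<in> carrier ?T" for x y
      using that by (cases x; cases y) (simp add: tri)
    show "\<zero>\<^bsub>?T\<^esub> \<in> carrier ?T" by (simp add: tri)
    show "x \<oplus>\<^bsub>?T\<^esub> y \<oplus>\<^bsub>?T\<^esub> z = x \<oplus>\<^bsub>?T\<^esub> (y \<oplus>\<^bsub>?T\<^esub> z)"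
      if "x \<in> carrier ?T" "y \<in> carrier ?T" "z \<in> carrier ?T" for x y z
      using that by (cases x; cases y; cases z)
        (simp add: tri R1.a_assoc R2.a_assoc R3.a_assoc M12.M.a_assoc M13.M.a_assoc M23.M.a_assoc)
    show "x \<oplus>\<^bsub>?T\<^esub> y = y \<oplus>\<^bsub>?T\<^esub> x" if "x \<in> carrier ?T" "y \<in> carrier ?T" for x y
      using that by (cases x; cases y)
        (simp add: tri R1.a_comm R2.a_comm R3.a_comm M12.M.a_comm M13.M.a_comm M23.M.a_comm)
    show "\<zero>\<^bsub>?T\<^esub> \<oplus>\<^bsub>?T\<^esub> x = x" if "x \<in> carrier ?T" for x
      using that by (cases x) (simp add: tri)
    fix x assume "x \<in> carrier ?T"
    then show "\<exists>y\<in>carrier ?T. y \<oplus>\<^bsub>?T\<^esub> x = \<zero>\<^bsub>?T\<^esub>"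
      by (cases x, intro bexI[of _ "Tri (\<ominus>\<^bsub>R1\<^esub> e11 x) (\<ominus>\<^bsub>M12\<^esub> e12 x) (\<ominus>\<^bsub>M13\<^esub> e13 x)
            (\<ominus>\<^bsub>R2\<^esub> e22 x) (\<ominus>\<^bsub>M23\<^esub> e23 x) (\<ominus>\<^bsub>R3\<^esub> e33 x)"])
        (simp_all add: tri R1.l_neg R2.l_neg R3.l_neg M12.M.l_neg M13.M.l_neg M23.M.l_neg)
  qed
  show "monoid ?T"
  proof (rule monoidI)
    show "x \<otimes>\<^bsub>?T\<^esub> y \<in> carrier ?T" if "x \<in> carrier ?T" "y \<in> carrier ?T" for x y
      using that by (cases x; cases y) (simp add: tri cl)
    show "\<one>\<^bsub>?T\<^esub> \<in> carrier ?T" by (simp add: tri)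
    show "x \<otimes>\<^bsub>?T\<^esub> y \<otimes>\<^bsub>?T\<^esub> z = x \<otimes>\<^bsub>?T\<^esub> (y \<otimes>\<^bsub>?T\<^esub> z)"
      if "x \<in> carrier ?T" "y \<in> carrier ?T" "z \<in> carrier ?T" for x y z
      using that by (cases x; cases y; cases z)
        (simp add: tri cl ac R1.m_assoc R2.m_assoc R3.m_assoc
          M12.M.a_ac M13.M.a_ac M23.M.a_ac)
    show "\<one>\<^bsub>?T\<^esub> \<otimes>\<^bsub>?T\<^esub> x = x" "x \<otimes>\<^bsub>?T\<^esub> \<one>\<^bsub>?T\<^esub> = x" if "x \<in> carrier ?T" for x
      using that by (cases x; simp add: tri cl zr ac)+
  qed
  show "(x \<oplus>\<^bsub>?T\<^esub> y) \<otimes>\<^bsub>?T\<^esub> z = x \<otimes>\<^bsub>?T\<^esub> z \<oplus>\<^bsub>?T\<^esub> y \<otimes>\<^bsub>?T\<^esub> z"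
    and "z \<otimes>\<^bsub>?T\<^esub> (x \<oplus>\<^bsub>?T\<^esub> y) = z \<otimes>\<^bsub>?T\<^esub> x \<oplus>\<^bsub>?T\<^esub> z \<otimes>\<^bsub>?T\<^esub> y"
    if "x \<in> carrier ?T" "y \<in> carrier ?T" "z \<in> carrier ?T" for x y z
    using that
    by (cases x; cases y; cases z; simp add: tri cl ac R1.l_distr R2.l_distr R3.l_distr
          R1.r_distr R2.r_distr R3.r_distr M12.M.a_ac M13.M.a_ac M23.M.a_ac)+
qed

end

end

theory Submission
  imports Defs "HOL-Algebra.Multiplicative_Group"
begin

text \<open>A triangular matrix ring is a ring with a linearly ordered finite family of orthogonal idempotents \<open>e i\<close>
summing to \<open>1\<close> such that \<open>e i R e j = 0\<close> for \<open>j < i\<close>.  All computations take place in the entries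
\<open>e j x e k\<close>, for any finite number of idempotents from two on.  Write
\<open>block j k\<close> for \<open>e j R e k\<close>.

Subtracting an inner derivation \<open>[n, -]\<close> removes the off-diagonal entries of all \<open>\<phi> (e i)\<close>: the
identities \<open>\<phi> [e i, e k] = 0\<close> say exactly that the entries of the \<open>\<phi> (e i)\<close> fit together to one
matrix \<open>n\<close>.  Then each \<open>\<phi> (e i)\<close> is central, so \<open>\<phi>\<close> commutes with all maps \<open>[e i, -]\<close>.  For \<open>j < k\<close>
the double bracket \<open>[[e j, x], e k]\<close> is the entry \<open>e j x e k\<close>; hence \<open>\<phi>\<close> maps
the \<open>(j, k)\<close> entry of \<open>x\<close> to the \<open>(j, k)\<close> entry of \<open>\<phi> x\<close> (\<open>phi_entry\<close>), and off the diagonal \<open>\<phi>\<close> is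
already entrywise.

Additivity on \<open>block j k\<close> comes from the identity \<open>[e j + m, e k + n] = m + n\<close> (\<open>phi_add\<close>).  On a diagonal
block, \<open>\<phi>\<close> need not preserve the block, but for \<open>a\<close> in \<open>block i i\<close> every other diagonal entry of \<open>\<phi> a\<close>
is central in its block.  By the hypothesis on centers it is therefore an entry of a central matrix \<open>z\<close>,
and \<open>\<phi> a - z\<close> lies in \<open>block i i\<close> (\<open>phi_diagonal_mod_center\<close>).  Correcting \<open>\<phi>\<close> in this way on
the diagonal blocks gives maps \<open>D i j\<close> on the blocks that satisfy the Leibniz rule.  For \<open>x\<close> in
\<open>block i j\<close> and \<open>y\<close> in \<open>block j k\<close> with \<open>i \<noteq> k\<close>, this is the Lie identity, because then \<open>x y = [x, y]\<close>.
On the diagonal blocks, both additivity and the Leibniz rule follow by acting on an off-diagonal block, which is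
faithful.

The \<open>D i j\<close> together form a derivation \<open>\<delta>\<close>.  The remainder \<open>\<phi> - \<delta>\<close> is diagonal and commutes with every
off-diagonal block, and by faithfulness such a matrix is central (\<open>centerI\<close>, \<open>remainder_central\<close>).  So \<open>\<phi>\<close> and \<open>\<delta>\<close>
have the same brackets with all elements, and the remainder vanishes on commutators.\<close>

section \<open>Brackets and derivations in a ring\<close>

text \<open>When \<open>p\<close> and \<open>q\<close> are idempotent this is the set \<open>p R q\<close>; as a set of fixed points it
needs no witnesses.\<close>

definition peirce :: "('a, 'x) ring_scheme \<Rightarrow> 'a \<Rightarrow> 'a \<Rightarrow> 'a set" where
  "peirce R p q = {x \<in> carrier R. p \<otimes>\<^bsub>R\<^esub> x \<otimes>\<^bsub>R\<^esub> q = x}"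

context ring
begin

abbreviation br where "br \<equiv> lie_bracket R"

lemma br_closed [simp, intro]:
  "x \<in> carrier R \<Longrightarrow> y \<in> carrier R \<Longrightarrow> br x y \<in> carrier R"
  by (simp add: lie_bracket_def)

lemma diff_zero [simp]: "x \<in> carrier R \<Longrightarrow> x \<ominus> \<zero> = x"
  by (simp add: minus_eq)

lemma diff_add_cancel: "x \<in> carrier R \<Longrightarrow> y \<in> carrier R \<Longrightarrow> (x \<ominus> y) \<oplus> y = x"
  by (simp add: minus_eq a_assoc l_neg)

lemma in_center_iff:
  "z \<in> ring_center R \<longleftrightarrow> z \<in> carrier R \<and> (\<forall>x\<in>carrier R. z \<otimes> x = x \<otimes> z)"
  by (auto simp: ring_center_def lie_bracket_def)

lemma br_swap: "x \<in> carrier R \<Longrightarrow> y \<in> carrier R \<Longrightarrow> br y x = \<ominus> br x y"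
  unfolding lie_bracket_def by algebra

lemma br_add_left:
  "x \<in> carrier R \<Longrightarrow> y \<in> carrier R \<Longrightarrow> z \<in> carrier R \<Longrightarrow> br (x \<oplus> y) z = br x z \<oplus> br y z"
  unfolding lie_bracket_def by algebra

lemma br_add_right:
  "x \<in> carrier R \<Longrightarrow> y \<in> carrier R \<Longrightarrow> z \<in> carrier R \<Longrightarrow> br z (x \<oplus> y) = br z x \<oplus> br z y"
  unfolding lie_bracket_def by algebra

lemma br_minus_left:
  "x \<in> carrier R \<Longrightarrow> y \<in> carrier R \<Longrightarrow> z \<in> carrier R \<Longrightarrow> br (x \<ominus> y) z = br x z \<ominus> br y z"
  unfolding lie_bracket_def by algebra

lemma br_minus_right:
  "x \<in> carrier R \<Longrightarrow> y \<in> carrier R \<Longrightarrow> z \<in> carrier R \<Longrightarrow> br z (x \<ominus> y) = br z x \<ominus> br z y"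
  unfolding lie_bracket_def by algebra

lemma br_mult:
  "x \<in> carrier R \<Longrightarrow> y \<in> carrier R \<Longrightarrow> z \<in> carrier R \<Longrightarrow>
   br z (x \<otimes> y) = br z x \<otimes> y \<oplus> x \<otimes> br z y"
  unfolding lie_bracket_def by algebra

lemma jacobi:
  "n \<in> carrier R \<Longrightarrow> x \<in> carrier R \<Longrightarrow> y \<in> carrier R \<Longrightarrow>
   br n (br x y) = br (br n x) y \<oplus> br x (br n y)"
  unfolding lie_bracket_def by algebra

lemma br_center:
  "z \<in> ring_center R \<Longrightarrow> x \<in> carrier R \<Longrightarrow> br z x = \<zero>"
  "z \<in> ring_center R \<Longrightarrow> x \<in> carrier R \<Longrightarrow> br x z = \<zero>"
  by (simp_all add: in_center_iff lie_bracket_def)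

lemma inner_derivation: "n \<in> carrier R \<Longrightarrow> ring_derivation R (br n)"
  by (simp add: ring_derivation_def br_add_right br_mult)

lemma derivation_add:
  assumes "ring_derivation R d" "ring_derivation R d'"
  shows "ring_derivation R (\<lambda>x. d x \<oplus> d' x)"
proof -
  have d: "d x \<in> carrier R" "d' x \<in> carrier R" if "x \<in> carrier R" for x
    using assms that by (auto simp: ring_derivation_def)
  have add: "d (x \<oplus> y) = d x \<oplus> d y" "d' (x \<oplus> y) = d' x \<oplus> d' y"
    and mult: "d (x \<otimes> y) = d x \<otimes> y \<oplus> x \<otimes> d y" "d' (x \<otimes> y) = d' x \<otimes> y \<oplus> x \<otimes> d' y"
    if "x \<in> carrier R" "y \<in> carrier R" for x y
    using assms that by (auto simp: ring_derivation_def)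
  show ?thesis
    unfolding ring_derivation_def
    by (auto simp: d add mult l_distr r_distr a_ac)
qed

lemma lie_derivation_zero:
  assumes "mult_lie_derivation R \<phi>"
  shows "\<phi> \<zero> = \<zero>"
proof -
  have c: "\<phi> \<zero> \<in> carrier R" using assms by (auto simp: mult_lie_derivation_def)
  have "br \<zero> \<zero> = \<zero>" by (simp add: lie_bracket_def)
  moreover have "\<phi> (br \<zero> \<zero>) = br (\<phi> \<zero>) \<zero> \<oplus> br \<zero> (\<phi> \<zero>)"
    using assms by (simp add: mult_lie_derivation_def)
  ultimately show ?thesis using c by (simp add: lie_bracket_def)
qed

lemma derivation_br:
  assumes d: "ring_derivation R d" and x: "x \<in> carrier R" and y: "y \<in> carrier R"
  shows "d (br x y) = br (d x) y \<oplus> br x (d y)"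
proof -
  have c: "d u \<in> carrier R" if "u \<in> carrier R" for u
    using d that by (auto simp: ring_derivation_def)
  have diff: "d (u \<ominus> v) = d u \<ominus> d v" if uv: "u \<in> carrier R" "v \<in> carrier R" for u v
  proof -
    have "d ((u \<ominus> v) \<oplus> v) = d (u \<ominus> v) \<oplus> d v"
      using d uv by (simp add: ring_derivation_def)
    moreover have "(u \<ominus> v) \<oplus> v = u"
      by (rule diff_add_cancel[OF uv])
    ultimately have "d u = d (u \<ominus> v) \<oplus> d v" by simp
    then show ?thesis using c uv by (simp add: minus_eq a_assoc r_neg)
  qed
  have "d (br x y) = (d x \<otimes> y \<oplus> x \<otimes> d y) \<ominus> (d y \<otimes> x \<oplus> y \<otimes> d x)"
    using d x y by (simp add: lie_bracket_def diff ring_derivation_def)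
  also have "\<dots> = br (d x) y \<oplus> br x (d y)"
    using c[OF x] c[OF y] x y unfolding lie_bracket_def by algebra
  finally show ?thesis .
qed

text \<open>By the Jacobi identity \<open>[n, -]\<close> is itself a Lie derivation, and the Lie identity is linear in the map.\<close>

lemma subtract_inner_derivation:
  assumes phi: "mult_lie_derivation R \<phi>" and n: "n \<in> carrier R"
  shows "mult_lie_derivation R (\<lambda>x. \<phi> x \<ominus> br n x)"
  unfolding mult_lie_derivation_def
proof (intro conjI ballI)
  have closed: "\<phi> x \<in> carrier R" if "x \<in> carrier R" for x
    using phi that by (auto simp: mult_lie_derivation_def)
  then show "(\<lambda>x. \<phi> x \<ominus> br n x) \<in> carrier R \<rightarrow> carrier R"
    using n by simp
  fix x y assume xy: "x \<in> carrier R" "y \<in> carrier R"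
  then have "\<phi> (br x y) = br (\<phi> x) y \<oplus> br x (\<phi> y)"
    using phi by (simp add: mult_lie_derivation_def)
  moreover note jacobi[OF n xy] br_minus_left[OF closed[OF xy(1)] _ xy(2), of "br n x"]
    br_minus_right[OF closed[OF xy(2)] _ xy(1), of "br n y"]
  ultimately show "\<phi> (br x y) \<ominus> br n (br x y) = br (\<phi> x \<ominus> br n x) y \<oplus> br x (\<phi> y \<ominus> br n y)"
    using xy n closed[OF xy(1)] closed[OF xy(2)] by (simp add: a_minus_def minus_add a_ac)
qed

end

section \<open>Peirce decomposition of a generalized triangular matrix ring\<close>

text \<open>The internal description of a triangular matrix ring whose off-diagonal bimodules are faithful on both sides.
At least one off-diagonal block must meet each diagonal block, whence \<open>other_index\<close>: over a single
idempotent faithfulness would say nothing.\<close>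

locale triangular_idempotents = ring R for R (structure) +
  fixes I :: "'i::linorder set" and e :: "'i \<Rightarrow> 'a"
  assumes finite_I: "finite I"
    and other_index: "i \<in> I \<Longrightarrow> \<exists>j\<in>I. j \<noteq> i"
    and e_closed [simp, intro]: "i \<in> I \<Longrightarrow> e i \<in> carrier R"
    and e_mult: "i \<in> I \<Longrightarrow> j \<in> I \<Longrightarrow> e i \<otimes> e j = (if i = j then e i else \<zero>)"
    and e_sum: "(\<Oplus>i\<in>I. e i) = \<one>"
    and lower_zero: "i \<in> I \<Longrightarrow> j \<in> I \<Longrightarrow> j < i \<Longrightarrow> x \<in> carrier R \<Longrightarrow> e i \<otimes> x \<otimes> e j = \<zero>"
    and faithful_left: "i \<in> I \<Longrightarrow> j \<in> I \<Longrightarrow> i < j \<Longrightarrow> a \<in> peirce R (e i) (e i) \<Longrightarrow>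
      (\<And>m. m \<in> peirce R (e i) (e j) \<Longrightarrow> a \<otimes> m = \<zero>) \<Longrightarrow> a = \<zero>"
    and faithful_right: "i \<in> I \<Longrightarrow> j \<in> I \<Longrightarrow> i < j \<Longrightarrow> b \<in> peirce R (e j) (e j) \<Longrightarrow>
      (\<And>m. m \<in> peirce R (e i) (e j) \<Longrightarrow> m \<otimes> b = \<zero>) \<Longrightarrow> b = \<zero>"
begin

abbreviation block where "block i j \<equiv> peirce R (e i) (e j)"
abbreviation entry where "entry i j x \<equiv> e i \<otimes> x \<otimes> e j"

lemma blockD: "x \<in> block i j \<Longrightarrow> x \<in> carrier R"
  by (simp add: peirce_def)

lemma e_left: "i \<in> I \<Longrightarrow> k \<in> I \<Longrightarrow> x \<in> carrier R \<Longrightarrow>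
    e k \<otimes> (e i \<otimes> x) = (if k = i then e i \<otimes> x else \<zero>)"
  by (simp add: e_mult flip: m_assoc)

lemma e_right: "i \<in> I \<Longrightarrow> k \<in> I \<Longrightarrow> x \<in> carrier R \<Longrightarrow>
    x \<otimes> e i \<otimes> e k = (if k = i then x \<otimes> e i else \<zero>)"
  by (simp add: e_mult m_assoc)

lemma entry_in_block:
  "i \<in> I \<Longrightarrow> j \<in> I \<Longrightarrow> x \<in> carrier R \<Longrightarrow> entry i j x \<in> block i j"
  by (simp add: peirce_def m_assoc e_left e_right e_mult)

lemma block_left:
  assumes "i \<in> I" "j \<in> I" "k \<in> I" "x \<in> block i j"
  shows "e k \<otimes> x = (if k = i then x else \<zero>)"
proof -
  have "x = e i \<otimes> (x \<otimes> e j)" "x \<in> carrier R"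
    using assms by (auto simp: peirce_def m_assoc)
  then show ?thesis
    using e_left[of i k "x \<otimes> e j"] assms by simp
qed

lemma block_right:
  assumes "i \<in> I" "j \<in> I" "k \<in> I" "x \<in> block i j"
  shows "x \<otimes> e k = (if k = j then x else \<zero>)"
proof -
  have "x = e i \<otimes> x \<otimes> e j" "x \<in> carrier R"
    using assms by (auto simp: peirce_def)
  then show ?thesis
    using e_right[of j k "e i \<otimes> x"] assms by simp
qed

lemma entry_of_block:
  assumes "i \<in> I" "j \<in> I" "k \<in> I" "l \<in> I" "x \<in> block i j"
  shows "entry k l x = (if k = i \<and> l = j then x else \<zero>)"
  using assms by (simp add: block_left[OF assms(1,2)] block_right[OF assms(1,2)])

lemma entry_e_left:
  "i \<in> I \<Longrightarrow> j \<in> I \<Longrightarrow> k \<in> I \<Longrightarrow> x \<in> carrier R \<Longrightarrow>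
   entry j k (e i \<otimes> x) = (if i = j then entry j k x else \<zero>)"
  by (simp add: e_left)

lemma entry_e_right:
  "i \<in> I \<Longrightarrow> j \<in> I \<Longrightarrow> k \<in> I \<Longrightarrow> x \<in> carrier R \<Longrightarrow>
   entry j k (x \<otimes> e i) = (if i = k then entry j k x else \<zero>)"
  using e_right[of i k "e j \<otimes> x"] by (simp add: m_assoc)

text \<open>The blocks below the diagonal are kept, as zero blocks, so that statements about \<open>block i j\<close> need no
ordering of the indices.\<close>

lemma block_lower: "i \<in> I \<Longrightarrow> j \<in> I \<Longrightarrow> j < i \<Longrightarrow> x \<in> block i j \<Longrightarrow> x = \<zero>"
  using lower_zero[of i j x] by (simp add: peirce_def)

lemma zero_in_block: "i \<in> I \<Longrightarrow> j \<in> I \<Longrightarrow> \<zero> \<in> block i j"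
  by (simp add: peirce_def)

lemma block_add:
  "i \<in> I \<Longrightarrow> j \<in> I \<Longrightarrow> x \<in> block i j \<Longrightarrow> y \<in> block i j \<Longrightarrow> x \<oplus> y \<in> block i j"
  by (simp add: peirce_def l_distr r_distr)

lemma entry_minus:
  "i \<in> I \<Longrightarrow> j \<in> I \<Longrightarrow> x \<in> carrier R \<Longrightarrow> y \<in> carrier R \<Longrightarrow>
   entry i j (x \<ominus> y) = entry i j x \<ominus> entry i j y"
  using e_closed[of i] e_closed[of j] by algebra

lemma entry_add:
  "i \<in> I \<Longrightarrow> j \<in> I \<Longrightarrow> x \<in> carrier R \<Longrightarrow> y \<in> carrier R \<Longrightarrow>
   entry i j (x \<oplus> y) = entry i j x \<oplus> entry i j y"
  using e_closed[of i] e_closed[of j] by algebra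

lemma block_minus:
  "i \<in> I \<Longrightarrow> j \<in> I \<Longrightarrow> x \<in> block i j \<Longrightarrow> y \<in> block i j \<Longrightarrow> x \<ominus> y \<in> block i j"
  by (simp add: peirce_def entry_minus)

lemma block_mult:
  assumes "i \<in> I" "j \<in> I" "k \<in> I" "x \<in> block i j" "y \<in> block j k"
  shows "x \<otimes> y \<in> block i k"
proof -
  have "entry i k (x \<otimes> y) = (e i \<otimes> x) \<otimes> (y \<otimes> e k)"
    using assms blockD[OF assms(4)] blockD[OF assms(5)] by (simp add: m_assoc)
  also have "\<dots> = x \<otimes> y"
    using assms by (simp add: block_left[of i j] block_right[of j k])
  finally show ?thesis using assms blockD[OF assms(4)] blockD[OF assms(5)] by (simp add: peirce_def)
qed

lemma block_mult_zero:
  assumes "i \<in> I" "j \<in> I" "k \<in> I" "l \<in> I" "j \<noteq> k" "x \<in> block i j" "y \<in> block k l"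
  shows "x \<otimes> y = \<zero>"
proof -
  have "x \<otimes> y = (x \<otimes> e j) \<otimes> y"
    using assms by (simp add: block_right[of i j])
  also have "\<dots> = x \<otimes> (e j \<otimes> y)"
    using assms blockD[OF assms(6)] blockD[OF assms(7)] by (simp add: m_assoc)
  also have "\<dots> = \<zero>"
    using assms blockD[OF assms(6)] by (simp add: block_left[of k l])
  finally show ?thesis .
qed

text \<open>Multiply by \<open>1 = (\<Sum>i. e i)\<close> on both sides.\<close>

lemma peirce_decomposition:
  assumes "x \<in> carrier R"
  shows "x = (\<Oplus>i\<in>I. \<Oplus>j\<in>I. entry i j x)"
proof -
  have "x = (\<Oplus>i\<in>I. e i) \<otimes> x"
    using assms by (simp add: e_sum)
  also have "\<dots> = (\<Oplus>i\<in>I. e i \<otimes> x)"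
    using assms by (simp add: finsum_ldistr finite_I Pi_def)
  also have "\<dots> = (\<Oplus>i\<in>I. e i \<otimes> x \<otimes> (\<Oplus>j\<in>I. e j))"
    using assms by (intro finsum_cong) (auto simp: e_sum simp_implies_def)
  also have "\<dots> = (\<Oplus>i\<in>I. \<Oplus>j\<in>I. entry i j x)"
    using assms by (intro finsum_cong) (auto simp: finsum_rdistr finite_I Pi_def simp_implies_def)
  finally show ?thesis .
qed

lemma entry_ext:
  assumes "x \<in> carrier R" "y \<in> carrier R"
    and "\<And>i j. i \<in> I \<Longrightarrow> j \<in> I \<Longrightarrow> entry i j x = entry i j y"
  shows "x = y"
proof -
  have "(\<Oplus>i\<in>I. \<Oplus>j\<in>I. entry i j x) = (\<Oplus>i\<in>I. \<Oplus>j\<in>I. entry i j y)"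
    using assms by (intro finsum_cong) (auto simp: simp_implies_def intro!: finsum_closed finsum_cong)
  then show ?thesis
    using peirce_decomposition assms(1,2) by metis
qed

lemma entry_finsum:
  assumes "i \<in> I" "j \<in> I" "finite K" "g \<in> K \<rightarrow> carrier R"
  shows "entry i j (\<Oplus>k\<in>K. g k) = (\<Oplus>k\<in>K. entry i j (g k))"
  using assms by (simp add: finsum_ldistr finsum_rdistr Pi_def)

lemma entry_mult:
  assumes "i \<in> I" "j \<in> I" "x \<in> carrier R" "y \<in> carrier R"
  shows "entry i j (x \<otimes> y) = (\<Oplus>k\<in>I. entry i k x \<otimes> entry k j y)"
proof -
  have "entry i j (x \<otimes> y) = (e i \<otimes> x) \<otimes> (\<Oplus>k\<in>I. e k) \<otimes> (y \<otimes> e j)"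
    using assms by (simp add: e_sum m_assoc)
  also have "\<dots> = (\<Oplus>k\<in>I. (e i \<otimes> x) \<otimes> e k \<otimes> (y \<otimes> e j))"
    using assms by (simp add: finsum_rdistr finsum_ldistr finite_I Pi_def)
  also have "\<dots> = (\<Oplus>k\<in>I. entry i k x \<otimes> entry k j y)"
  proof (intro finsum_cong)
    have "e i \<otimes> x \<otimes> e k \<otimes> (y \<otimes> e j) = entry i k x \<otimes> entry k j y" if k: "k \<in> I" for k
    proof -
      have "entry i k x = entry i k x \<otimes> e k"
        using assms k by (simp add: e_right)
      then have "entry i k x \<otimes> (y \<otimes> e j) = (entry i k x \<otimes> e k) \<otimes> (y \<otimes> e j)" by simp
      then show ?thesis using assms k by (simp add: m_assoc)
    qed
    then show "k \<in> I =simp=> e i \<otimes> x \<otimes> e k \<otimes> (y \<otimes> e j) = entry i k x \<otimes> entry k j y" for k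
      by (simp add: simp_implies_def)
  qed (use assms in auto)
  finally show ?thesis .
qed

text \<open>An element of a single block sees only one diagonal entry of its left or right factor.\<close>

lemma entry_mult_block:
  assumes "j \<in> I" "k \<in> I" "m \<in> block j k" "x \<in> carrier R"
  shows "entry j k (x \<otimes> m) = entry j j x \<otimes> m"
    and "entry j k (m \<otimes> x) = m \<otimes> entry k k x"
proof -
  have m: "e j \<otimes> m = m" "m \<otimes> e k = m" "m \<in> carrier R"
    using assms blockD[OF assms(3)] by (auto simp: block_left[of j k] block_right[of j k])
  show "entry j k (x \<otimes> m) = entry j j x \<otimes> m"
    using m assms by (simp add: m_assoc)
  have "entry j k (m \<otimes> x) = (e j \<otimes> m) \<otimes> x \<otimes> e k"
    using m(3) assms by (simp only: m_assoc e_closed m_closed)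
  also have "\<dots> = (m \<otimes> e k) \<otimes> x \<otimes> e k" by (simp only: m)
  also have "\<dots> = m \<otimes> entry k k x" 
    using m(3) assms by (simp only: m_assoc e_closed m_closed)
  finally show "entry j k (m \<otimes> x) = m \<otimes> entry k k x" .
qed

text \<open>Every matrix of block elements is the matrix of entries of a ring element.  This is how the conjugating element
of the inner derivation and the values of the derivation are constructed.\<close>

lemma entries_assemble:
  assumes c: "\<And>i j. i \<in> I \<Longrightarrow> j \<in> I \<Longrightarrow> c i j \<in> block i j"
  defines "s \<equiv> \<Oplus>i\<in>I. \<Oplus>j\<in>I. c i j"
  shows "s \<in> carrier R" and "\<And>k l. k \<in> I \<Longrightarrow> l \<in> I \<Longrightarrow> entry k l s = c k l"
proof -
  have cc: "c i j \<in> carrier R" if "i \<in> I" "j \<in> I" for i j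
    using blockD[OF c[OF that]] .
  show "s \<in> carrier R"
    unfolding s_def using cc by (intro finsum_closed) auto
  fix k l assume kl: "k \<in> I" "l \<in> I"
  have "entry k l s = (\<Oplus>i\<in>I. \<Oplus>j\<in>I. entry k l (c i j))"
    unfolding s_def using kl cc finite_I
    by (subst entry_finsum; (simp add: Pi_def)?)
      (intro finsum_cong; auto simp: simp_implies_def entry_finsum Pi_def)
  also have "\<dots> = (\<Oplus>i\<in>I. if k = i then c k l else \<zero>)"
  proof (intro finsum_cong)
    show "i \<in> I =simp=> (\<Oplus>j\<in>I. entry k l (c i j)) = (if k = i then c k l else \<zero>)" for i
    proof (unfold simp_implies_def)
      assume i: "i \<in> I"
      have "(\<Oplus>j\<in>I. entry k l (c i j)) = (\<Oplus>j\<in>I. if l = j then (if k = i then c k l else \<zero>) else \<zero>)"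
        using kl i cc by (intro finsum_cong) (auto simp: simp_implies_def entry_of_block[OF _ _ _ _ c])
      also have "\<dots> = (if k = i then c k l else \<zero>)"
        using kl cc finite_I by (subst finsum_singleton) auto
      finally show "(\<Oplus>j\<in>I. entry k l (c i j)) = (if k = i then c k l else \<zero>)" .
    qed
  qed (use kl cc in auto)
  also have "\<dots> = c k l"
    using kl cc finite_I by (subst finsum_singleton) auto
  finally show "entry k l s = c k l" .
qed

lemma center_entry:
  assumes z: "z \<in> ring_center R"
  shows "i \<in> I \<Longrightarrow> j \<in> I \<Longrightarrow> i \<noteq> j \<Longrightarrow> entry i j z = \<zero>"
    and "j \<in> I \<Longrightarrow> k \<in> I \<Longrightarrow> m \<in> block j k \<Longrightarrow> entry j j z \<otimes> m = m \<otimes> entry k k z"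
proof -
  have zc: "z \<in> carrier R" and comm: "\<And>x. x \<in> carrier R \<Longrightarrow> z \<otimes> x = x \<otimes> z"
    using z by (auto simp: in_center_iff)
  show "entry i j z = \<zero>" if "i \<in> I" "j \<in> I" "i \<noteq> j"
    using comm[of "e i"] e_right[of i j z] that zc by simp
  show "entry j j z \<otimes> m = m \<otimes> entry k k z" if "j \<in> I" "k \<in> I" "m \<in> block j k"
    using entry_mult_block[OF that zc] comm[OF blockD[OF that(3)]] by simp
qed

text \<open>Faithfulness in the form in which it is applied: equations between diagonal elements may be tested on one
off-diagonal block.\<close>

lemma left_faithful_eq:
  assumes "i \<in> I" "j \<in> I" "i < j" "a \<in> block i i" "b \<in> block i i"
    and "\<And>m. m \<in> block i j \<Longrightarrow> a \<otimes> m = b \<otimes> m"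
  shows "a = b"
proof -
  have "(a \<ominus> b) \<otimes> m = \<zero>" if "m \<in> block i j" for m
  proof -
    have "(a \<ominus> b) \<otimes> m = a \<otimes> m \<ominus> b \<otimes> m"
      using blockD[OF that] blockD[OF assms(4)] blockD[OF assms(5)] by algebra
    then show ?thesis using assms(6)[OF that] blockD[OF that] blockD[OF assms(5)] by simp
  qed
  then have "a \<ominus> b = \<zero>"
    by (rule faithful_left[OF assms(1-3) block_minus[OF assms(1,1,4,5)]])
  then show ?thesis using blockD[OF assms(4)] blockD[OF assms(5)] by simp
qed

lemma right_faithful_eq:
  assumes "i \<in> I" "j \<in> I" "i < j" "a \<in> block j j" "b \<in> block j j"
    and "\<And>m. m \<in> block i j \<Longrightarrow> m \<otimes> a = m \<otimes> b"
  shows "a = b"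
proof -
  have "m \<otimes> (a \<ominus> b) = \<zero>" if "m \<in> block i j" for m
  proof -
    have "m \<otimes> (a \<ominus> b) = m \<otimes> a \<ominus> m \<otimes> b"
      using blockD[OF that] blockD[OF assms(4)] blockD[OF assms(5)] by algebra
    then show ?thesis using assms(6)[OF that] blockD[OF that] blockD[OF assms(5)] by simp
  qed
  then have "a \<ominus> b = \<zero>"
    by (rule faithful_right[OF assms(1-3) block_minus[OF assms(2,2,4,5)]])
  then show ?thesis using blockD[OF assms(4)] blockD[OF assms(5)] by simp
qed

text \<open>A diagonal matrix that commutes with the off-diagonal blocks also commutes with the diagonal ones: for
\<open>a\<close> in \<open>block i i\<close> and \<open>m\<close> in \<open>block i l\<close>, moving the entries of \<open>z\<close> past \<open>m\<close> gives
\<open>z\<^sub>i a m = a m z\<^sub>l = a z\<^sub>i m\<close>, and \<open>m\<close> can be cancelled by faithfulness.  If \<open>i\<close> is the last index, the same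
argument runs on the other side.\<close>

lemma centerI:
  assumes zc: "z \<in> carrier R"
    and off: "\<And>j k. j \<in> I \<Longrightarrow> k \<in> I \<Longrightarrow> j < k \<Longrightarrow> entry j k z = \<zero>"
    and comm: "\<And>j k m. j \<in> I \<Longrightarrow> k \<in> I \<Longrightarrow> j < k \<Longrightarrow> m \<in> block j k \<Longrightarrow>
      entry j j z \<otimes> m = m \<otimes> entry k k z"
  shows "z \<in> ring_center R"
proof -
  have diag: "entry j k z = \<zero>" if "j \<in> I" "k \<in> I" "j \<noteq> k" for j k
    using off[of j k] lower_zero[of j k z] that zc by (meson linorder_neqE)
  have left: "e i \<otimes> z = entry i i z" if i: "i \<in> I" for i
  proof (rule entry_ext)
    fix j k assume jk: "j \<in> I" "k \<in> I"
    have "entry j k (e i \<otimes> z) = (if j = i then entry i k z else \<zero>)"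
      using i jk zc e_left[of i j z] by simp
    also have "\<dots> = entry j k (entry i i z)"
      using diag[OF i, of k] entry_of_block[OF i i jk entry_in_block[OF i i zc]] jk by auto
    finally show "entry j k (e i \<otimes> z) = entry j k (entry i i z)" .
  qed (use i zc in simp_all)
  have right: "z \<otimes> e i = entry i i z" if i: "i \<in> I" for i
  proof (rule entry_ext)
    fix j k assume jk: "j \<in> I" "k \<in> I"
    have "entry j k (z \<otimes> e i) = entry j i z \<otimes> e k"
      using i jk zc by (simp add: m_assoc)
    also have "\<dots> = (if k = i then entry j i z else \<zero>)"
      using i jk zc e_right[of i k "e j \<otimes> z"] by simp
    also have "\<dots> = entry j k (entry i i z)"
      using diag[OF _ i, of j] entry_of_block[OF i i jk entry_in_block[OF i i zc]] jk by auto
    finally show "entry j k (z \<otimes> e i) = entry j k (entry i i z)" .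
  qed (use i zc in simp_all)
  have comm_diag: "entry i i z \<otimes> a = a \<otimes> entry i i z" if i: "i \<in> I" and a: "a \<in> block i i" for i a
  proof -
    obtain l where l: "l \<in> I" "l \<noteq> i" using other_index i by auto
    have zi: "entry i i z \<in> block i i" using i zc by (simp add: entry_in_block)
    consider "i < l" | "l < i" using l(2) by (meson linorder_neqE)
    then show ?thesis
    proof cases
      case 1
      show ?thesis
      proof (rule left_faithful_eq[OF i l(1) 1])
        fix m assume m: "m \<in> block i l"
        have am: "a \<otimes> m \<in> block i l" using a m i l by (intro block_mult[of i i l]) auto
        have "entry i i z \<otimes> a \<otimes> m = entry i i z \<otimes> (a \<otimes> m)"
          using blockD[OF a] blockD[OF m] blockD[OF zi] by (intro m_assoc)
        also have "\<dots> = a \<otimes> (m \<otimes> entry l l z)"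
          using comm[OF i l(1) 1 am] blockD[OF a] blockD[OF m] zc l by (simp add: m_assoc)
        also have "\<dots> = a \<otimes> entry i i z \<otimes> m"
          using comm[OF i l(1) 1 m] blockD[OF a] blockD[OF m] blockD[OF zi] m_assoc[of a "entry i i z" m] by simp
        finally show "entry i i z \<otimes> a \<otimes> m = a \<otimes> entry i i z \<otimes> m" .
      qed (use i a zi in \<open>auto intro: block_mult[of i i i]\<close>)
    next
      case 2
      show ?thesis
      proof (rule right_faithful_eq[OF l(1) i 2])
        fix m assume m: "m \<in> block l i"
        have ma: "m \<otimes> a \<in> block l i" using a m i l by (intro block_mult[of l i i]) auto
        have "m \<otimes> (entry i i z \<otimes> a) = (m \<otimes> entry i i z) \<otimes> a"
          using blockD[OF a] blockD[OF m] blockD[OF zi] by (intro m_assoc[symmetric])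
        also have "\<dots> = entry l l z \<otimes> m \<otimes> a"
          using comm[OF l(1) i 2 m] by simp
        also have "\<dots> = m \<otimes> a \<otimes> entry i i z"
          using comm[OF l(1) i 2 ma] blockD[OF a] blockD[OF m] zc l by (simp add: m_assoc)
        also have "\<dots> = m \<otimes> (a \<otimes> entry i i z)"
          using blockD[OF a] blockD[OF m] blockD[OF zi] by (intro m_assoc)
        finally show "m \<otimes> (entry i i z \<otimes> a) = m \<otimes> (a \<otimes> entry i i z)" .
      qed (use i a zi in \<open>auto intro: block_mult[of i i i]\<close>)
    qed
  qed
  have "z \<otimes> x = x \<otimes> z" if x: "x \<in> carrier R" for x
  proof (rule entry_ext)
    fix i j assume ij: "i \<in> I" "j \<in> I"
    have xb: "entry i j x \<in> block i j" using ij x by (simp add: entry_in_block)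
    have "entry i j (z \<otimes> x) = (e i \<otimes> z) \<otimes> x \<otimes> e j"
      using ij x zc by (simp add: m_assoc)
    also have "\<dots> = entry i i z \<otimes> entry i j x"
      using ij x zc by (subst left) (simp_all add: m_assoc e_left)
    finally have 1: "entry i j (z \<otimes> x) = entry i i z \<otimes> entry i j x" .
    have "entry i j (x \<otimes> z) = e i \<otimes> x \<otimes> (z \<otimes> e j)"
      using ij x zc by (simp add: m_assoc)
    also have "\<dots> = entry i j x \<otimes> entry j j z"
      using ij x zc by (subst right) (simp_all add: m_assoc e_left)
    finally have 2: "entry i j (x \<otimes> z) = entry i j x \<otimes> entry j j z" .
    consider "i < j" | "i = j" | "j < i" by fastforce
    then have "entry i i z \<otimes> entry i j x = entry i j x \<otimes> entry j j z"
    proof cases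
      case 3 then show ?thesis using lower_zero[of i j x] ij x zc by simp
    qed (use comm comm_diag xb ij in auto)
    then show "entry i j (z \<otimes> x) = entry i j (x \<otimes> z)" using 1 2 by simp
  qed (use x zc in auto)
  then show ?thesis using zc by (simp add: in_center_iff)
qed

lemma blockI:
  assumes ij: "i \<in> I" "j \<in> I" and x: "x \<in> carrier R"
    and zero: "\<And>k l. k \<in> I \<Longrightarrow> l \<in> I \<Longrightarrow> (k, l) \<noteq> (i, j) \<Longrightarrow> entry k l x = \<zero>"
  shows "x \<in> block i j"
proof -
  have "entry i j x = x"
  proof (rule entry_ext)
    fix k l assume kl: "k \<in> I" "l \<in> I"
    show "entry k l (entry i j x) = entry k l x"
      using entry_of_block[OF ij kl entry_in_block[OF ij x]] zero[OF kl] by auto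
  qed (use ij x in auto)
  then show ?thesis using x by (simp add: peirce_def)
qed

lemma entry_br:
  assumes "j \<in> I" "k \<in> I" "x \<in> carrier R" "y \<in> carrier R"
  shows "entry j k (br x y) = entry j k (x \<otimes> y) \<ominus> entry j k (y \<otimes> x)"
  using assms by (simp add: lie_bracket_def entry_minus)

lemma entry_br_block:
  assumes "j \<in> I" "k \<in> I" "m \<in> block j k" "x \<in> carrier R"
  shows "entry j k (br x m) = entry j j x \<otimes> m \<ominus> m \<otimes> entry k k x"
  using entry_br[OF assms(1,2,4) blockD[OF assms(3)]] entry_mult_block[OF assms] by simp

lemma entry_br_idem:
  assumes "i \<in> I" "j \<in> I" "k \<in> I" "x \<in> carrier R"
  shows "entry j k (br (e i) x) = (if i = j then entry j k x else \<zero>) \<ominus> (if i = k then entry j k x else \<zero>)"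
  using entry_br[OF assms(2,3) e_closed[OF assms(1)] assms(4)] entry_e_left[OF assms] entry_e_right[OF assms]
  by simp

lemma entry_br_idem_right:
  assumes "i \<in> I" "j \<in> I" "k \<in> I" "x \<in> carrier R"
  shows "entry j k (br x (e i)) = (if i = k then entry j k x else \<zero>) \<ominus> (if i = j then entry j k x else \<zero>)"
  using entry_br[OF assms(2,3,4) e_closed[OF assms(1)]] entry_e_left[OF assms] entry_e_right[OF assms]
  by simp

text \<open>Extraction of an entry is a Lie polynomial in the idempotents.  This is why a map that commutes with the
brackets \<open>[e i, -]\<close> respects all entries above the diagonal, without being additive.\<close>

lemma double_bracket_idem:
  assumes "j \<in> I" "k \<in> I" "j < k" "x \<in> carrier R"
  shows "br (br (e j) x) (e k) = entry j k x"
proof -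
  have "br (br (e j) x) (e k) =
      entry j k x \<ominus> x \<otimes> (e j \<otimes> e k) \<ominus> ((e k \<otimes> e j) \<otimes> x \<ominus> entry k j x)"
    using e_closed[OF assms(1)] e_closed[OF assms(2)] assms(4) unfolding lie_bracket_def by algebra
  also have "\<dots> = entry j k x"
    using assms lower_zero[of k j x] less_imp_neq[OF assms(3)] by (simp add: e_mult)
  finally show ?thesis .
qed

end

section \<open>Lie derivations with diagonal values at the idempotents\<close>

text \<open>The situation after subtraction of an inner derivation.  The last assumption is the inclusion
\<open>Z(e i R e i) \<subseteq> e i Z(R) e i\<close>, with the center of the corner written out.\<close>

locale normalized_lie_derivation = triangular_idempotents R I e
  for R (structure) and I :: "'i::linorder set" and e :: "'i \<Rightarrow> 'a" +
  fixes \<phi> :: "'a \<Rightarrow> 'a"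
  assumes lie_derivation: "mult_lie_derivation R \<phi>"
    and idem_off_diagonal:
      "i \<in> I \<Longrightarrow> j \<in> I \<Longrightarrow> k \<in> I \<Longrightarrow> j < k \<Longrightarrow> e j \<otimes> \<phi> (e i) \<otimes> e k = \<zero>"
    and center_lift: "i \<in> I \<Longrightarrow> c \<in> peirce R (e i) (e i) \<Longrightarrow>
      (\<And>a. a \<in> peirce R (e i) (e i) \<Longrightarrow> c \<otimes> a = a \<otimes> c) \<Longrightarrow>
      \<exists>z\<in>ring_center R. e i \<otimes> z \<otimes> e i = c"
begin

lemma phi_closed [simp]: "x \<in> carrier R \<Longrightarrow> \<phi> x \<in> carrier R"
  using lie_derivation by (auto simp: mult_lie_derivation_def)

lemma phi_br:
  "x \<in> carrier R \<Longrightarrow> y \<in> carrier R \<Longrightarrow> \<phi> (br x y) = br (\<phi> x) y \<oplus> br x (\<phi> y)"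
  using lie_derivation by (simp add: mult_lie_derivation_def)

lemma phi_zero: "\<phi> \<zero> = \<zero>"
  by (rule lie_derivation_zero[OF lie_derivation])

lemma phi_br_swap:
  assumes "x \<in> carrier R" "y \<in> carrier R"
  shows "\<phi> (br y x) = \<ominus> \<phi> (br x y)"
proof -
  have "\<phi> (br y x) = br (\<phi> y) x \<oplus> br y (\<phi> x)"
    using phi_br assms by simp
  also have "\<dots> = \<ominus> br x (\<phi> y) \<oplus> \<ominus> br (\<phi> x) y"
    using br_swap[of x "\<phi> y"] br_swap[of "\<phi> x" y] assms by simp
  also have "\<dots> = \<ominus> \<phi> (br x y)"
    using assms by (simp add: phi_br minus_add a_comm)
  finally show ?thesis .
qed

lemma cancel_difference:
  "a \<in> carrier R \<Longrightarrow> b \<in> carrier R \<Longrightarrow> c \<in> carrier R \<Longrightarrow> c = (a \<ominus> b) \<oplus> c \<Longrightarrow> a = b"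
  by (metis add.r_cancel_one' minus_closed r_right_minus_eq)

text \<open>Compare the \<open>(j, k)\<close> entries in the Lie identity for \<open>[e i, m]\<close> with \<open>m\<close> in \<open>block j k\<close>.  Whether \<open>i\<close> is \<open>j\<close>,
\<open>k\<close> or neither, the contribution of \<open>\<phi> m\<close> cancels, and what remains is that the diagonal entries of \<open>\<phi> (e i)\<close>
commute with \<open>m\<close>.\<close>

lemma phi_idem_central:
  assumes i: "i \<in> I"
  shows "\<phi> (e i) \<in> ring_center R"
proof (rule centerI)
  show "\<phi> (e i) \<in> carrier R" using i by simp
  show "entry j k (\<phi> (e i)) = \<zero>" if "j \<in> I" "k \<in> I" "j < k" for j k
    using idem_off_diagonal i that by simp
  fix j k m assume jk: "j \<in> I" "k \<in> I" "j < k" and m: "m \<in> block j k"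
  let ?p = "\<phi> (e i)" and ?u = "entry j k (\<phi> m)"
  have c: "m \<in> carrier R" "?p \<in> carrier R" "\<phi> m \<in> carrier R" "?u \<in> carrier R"
    "entry j j ?p \<otimes> m \<in> carrier R" "m \<otimes> entry k k ?p \<in> carrier R"
    using blockD[OF m] jk i by auto
  have left: "entry j k (\<phi> (br (e i) m)) =
      (entry j j ?p \<otimes> m \<ominus> m \<otimes> entry k k ?p) \<oplus> entry j k (br (e i) (\<phi> m))"
    using c jk i by (simp add: phi_br entry_add entry_br_block[OF jk(1,2) m])
  have em: "e i \<otimes> m = (if i = j then m else \<zero>)" "m \<otimes> e i = (if i = k then m else \<zero>)"
    using block_left[OF jk(1,2) i m] block_right[OF jk(1,2) i m] by auto
  consider "i = j" | "i = k" | "i \<noteq> j" "i \<noteq> k" by auto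
  then show "entry j j ?p \<otimes> m = m \<otimes> entry k k ?p"
  proof cases
    case 1
    then have "br (e i) m = m" using em jk less_imp_neq[OF jk(3)] c by (simp add: lie_bracket_def)
    moreover have "entry j k (br (e i) (\<phi> m)) = ?u"
      using entry_br_idem[OF i jk(1,2) c(3)] 1 less_imp_neq[OF jk(3)] c by simp
    ultimately have "?u = (entry j j ?p \<otimes> m \<ominus> m \<otimes> entry k k ?p) \<oplus> ?u"
      using left by simp
    then show ?thesis by (rule cancel_difference[OF c(5,6,4)])
  next
    case 2
    \<comment> \<open>Here \<open>m\<close> is \<open>[m, e k]\<close> rather than \<open>[e k, m]\<close>, so the Lie identity is used with the bracket reversed.\<close>
    then have "?u = entry j k (\<phi> (br m (e i)))"
      using em jk less_imp_neq[OF jk(3)] c by (simp add: lie_bracket_def)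
    also have "\<dots> = entry j k (br (\<phi> m) (e i)) \<oplus> entry j k (br m ?p)"
      using jk i c by (simp add: phi_br entry_add)
    also have "entry j k (br (\<phi> m) (e i)) = ?u"
      using entry_br_idem_right[OF i jk(1,2) c(3)] 2 less_imp_neq[OF jk(3)] c by simp
    also have "entry j k (br m ?p) = m \<otimes> entry k k ?p \<ominus> entry j j ?p \<otimes> m"
      using entry_br[OF jk(1,2) c(1,2)] entry_mult_block[OF jk(1,2) m c(2)] by simp
    also have "?u \<oplus> (m \<otimes> entry k k ?p \<ominus> entry j j ?p \<otimes> m) = (m \<otimes> entry k k ?p \<ominus> entry j j ?p \<otimes> m) \<oplus> ?u"
      using c by (intro a_comm) auto
    finally show ?thesis by (rule cancel_difference[OF c(6,5,4), symmetric])
  next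
    case 3
    then have "br (e i) m = \<zero>" using em by (simp add: lie_bracket_def)
    then have "entry j k (\<phi> (br (e i) m)) = \<zero>" using jk by (simp add: phi_zero)
    then show ?thesis
      using left entry_br_idem[OF i jk(1,2) c(3)] 3 c by simp
  qed
qed

lemma phi_br_idem:
  assumes "i \<in> I" "x \<in> carrier R"
  shows "\<phi> (br (e i) x) = br (e i) (\<phi> x)" "\<phi> (br x (e i)) = br (\<phi> x) (e i)"
  using assms by (simp_all add: phi_br br_center phi_idem_central)

lemma phi_entry:
  assumes "j \<in> I" "k \<in> I" "j < k" "x \<in> carrier R"
  shows "\<phi> (entry j k x) = entry j k (\<phi> x)"
  using double_bracket_idem[OF assms] double_bracket_idem[OF assms(1-3) phi_closed[OF assms(4)]]
    phi_br_idem assms by (metis br_closed e_closed)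

lemma phi_block:
  assumes "j \<in> I" "k \<in> I" "j < k" "m \<in> block j k"
  shows "\<phi> m \<in> block j k"
proof -
  have "entry j k m = m" "m \<in> carrier R" using assms(4) by (auto simp: peirce_def)
  then show ?thesis
    using phi_entry[OF assms(1-3), of m] entry_in_block[OF assms(1,2), of "\<phi> m"] by simp
qed

text \<open>Oddness is automatic on brackets, and \<open>m = [e j, m]\<close>.\<close>

lemma phi_a_inv:
  assumes "j \<in> I" "k \<in> I" "j < k" "m \<in> block j k"
  shows "\<phi> (\<ominus> m) = \<ominus> \<phi> m"
proof -
  have c: "m \<in> carrier R" using assms blockD by blast
  have "br (e j) m = m"
    using c assms block_left[of j k j m] block_right[of j k j m] less_imp_neq[OF assms(3)]
    by (simp add: lie_bracket_def)
  then show ?thesis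
    using phi_br_swap[of "e j" m] br_swap[of "e j" m] assms c by simp
qed

text \<open>The Lie identity for \<open>[x, m]\<close>, read off in the block of \<open>m\<close>.  It relates the diagonal of \<open>\<phi> x\<close> to the
diagonal of \<open>x\<close> and is used for the additivity of \<open>\<phi>\<close>, for the diagonal blocks and for the remainder.\<close>

lemma phi_action:
  assumes jk: "j \<in> I" "k \<in> I" "j < k" and m: "m \<in> block j k" and x: "x \<in> carrier R"
  shows "\<phi> (entry j j x \<otimes> m \<ominus> m \<otimes> entry k k x) =
    (entry j j (\<phi> x) \<otimes> m \<ominus> m \<otimes> entry k k (\<phi> x)) \<oplus>
    (entry j j x \<otimes> \<phi> m \<ominus> \<phi> m \<otimes> entry k k x)"
proof -
  have c: "m \<in> carrier R" "\<phi> m \<in> carrier R" using blockD[OF m] by auto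
  have "\<phi> (entry j j x \<otimes> m \<ominus> m \<otimes> entry k k x) = \<phi> (entry j k (br x m))"
    by (simp add: entry_br_block[OF jk(1,2) m x])
  also have "\<dots> = entry j k (\<phi> (br x m))"
    using phi_entry jk c x by simp
  also have "\<dots> = entry j k (br (\<phi> x) m) \<oplus> entry j k (br x (\<phi> m))"
    using c x jk by (simp add: phi_br entry_add)
  finally show ?thesis
    using entry_br_block[OF jk(1,2)] m phi_block[OF jk m] x by simp
qed

text \<open>The sum is a single bracket, \<open>m + n = [e j + m, e k + n]\<close>.  By \<open>phi_action\<close> the diagonal entries of
\<open>\<phi> (e j + m)\<close> commute with \<open>n\<close> and those of \<open>\<phi> (e k + n)\<close> commute with \<open>m\<close>, so they contribute nothing to
\<open>\<phi> [e j + m, e k + n]\<close>, and only the off-diagonal entries \<open>\<phi> m\<close> and \<open>\<phi> n\<close> remain.\<close>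

lemma phi_add:
  assumes jk: "j \<in> I" "k \<in> I" "j < k" and m: "m \<in> block j k" and n: "n \<in> block j k"
  shows "\<phi> (m \<oplus> n) = \<phi> m \<oplus> \<phi> n"
proof -
  let ?x = "e j \<oplus> m" and ?y = "e k \<oplus> n"
  let ?u = "\<phi> ?x" and ?v = "\<phi> ?y"
  have c: "m \<in> carrier R" "n \<in> carrier R" "\<phi> m \<in> carrier R" "\<phi> n \<in> carrier R"
    "?x \<in> carrier R" "?y \<in> carrier R" "?u \<in> carrier R" "?v \<in> carrier R"
    using blockD[OF m] blockD[OF n] jk by auto
  have ne: "j \<noteq> k" "k \<noteq> j" using jk(3) by auto
  have ent: "entry j j ?x = e j" "entry k k ?x = \<zero>" "entry j k ?x = m"
    "entry j j ?y = \<zero>" "entry k k ?y = e k" "entry j k ?y = n"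
    using c jk ne entry_of_block[OF jk(1,2) _ _ m] entry_of_block[OF jk(1,2) _ _ n]
    by (simp_all add: entry_add e_mult)
  have left: "e j \<otimes> m = m" "e k \<otimes> m = \<zero>" "e j \<otimes> n = n" "e k \<otimes> n = \<zero>"
    "e j \<otimes> \<phi> n = \<phi> n" "e k \<otimes> \<phi> m = \<zero>"
    using block_left[OF jk(1,2)] m n jk ne phi_block[OF jk] by auto
  have right: "m \<otimes> e k = m" "m \<otimes> e j = \<zero>" "n \<otimes> e k = n" "n \<otimes> e j = \<zero>"
    "\<phi> m \<otimes> e k = \<phi> m" 
    using block_right[OF jk(1,2)] m n jk ne phi_block[OF jk] by auto
  have "\<phi> n = (entry j j ?u \<otimes> n \<ominus> n \<otimes> entry k k ?u) \<oplus> \<phi> n"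
    using phi_action[OF jk n c(5)] c left by (simp add: ent)
  then have u: "entry j j ?u \<otimes> n = n \<otimes> entry k k ?u"
    by (rule cancel_difference[rotated 3]) (use c jk in simp_all)
  have "\<ominus> \<phi> m = (entry j j ?v \<otimes> m \<ominus> m \<otimes> entry k k ?v) \<oplus> \<ominus> \<phi> m"
    using phi_action[OF jk m c(6)] c right phi_a_inv[OF jk m] by (simp add: ent minus_eq)
  then have v: "entry j j ?v \<otimes> m = m \<otimes> entry k k ?v"
    by (rule cancel_difference[rotated 3]) (use c jk in simp_all)
  have mn: "m \<otimes> n = \<zero>" "n \<otimes> m = \<zero>"
    using block_mult_zero[OF jk(1,2) jk(1,2)] m n ne by auto
  have br_xy: "br ?x ?y = m \<oplus> n"
    using c jk left right mn ne
    by (simp add: lie_bracket_def l_distr r_distr e_mult a_ac)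
  have sum_entry: "entry j k (m \<oplus> n) = m \<oplus> n"
    using m n jk by (simp add: entry_add entry_of_block[OF jk(1,2) jk(1,2)] c)
  have "\<phi> (m \<oplus> n) = entry j k (\<phi> (br ?x ?y))"
    using phi_entry[OF jk, of "m \<oplus> n"] c sum_entry br_xy by simp
  also have "\<dots> = entry j k (br ?u ?y) \<oplus> entry j k (br ?x ?v)"
    using c jk by (simp add: phi_br entry_add)
  also have "entry j k (br ?u ?y) = entry j k (br ?u (e k)) \<oplus> entry j k (br ?u n)"
    using c jk by (simp add: br_add_right entry_add)
  also have "\<dots> = \<phi> m"
    using entry_br_idem_right[OF jk(2) jk(1,2) c(7)] phi_entry[OF jk c(5)] ent ne
      entry_br_block[OF jk(1,2) n c(7)] u c jk by simp
  also have "entry j k (br ?x ?v) = entry j k (br (e j) ?v) \<oplus> entry j k (br m ?v)"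
    using c jk by (simp add: br_add_left entry_add)
  also have "\<dots> = \<phi> n"
    using entry_br_idem[OF jk(1) jk(1,2) c(8)] phi_entry[OF jk c(6)] ent ne
      entry_br[OF jk(1,2) c(1,8)] entry_mult_block[OF jk(1,2) m c(8)] v c jk by simp
  finally show ?thesis .
qed

lemma phi_minus:
  assumes "j \<in> I" "k \<in> I" "j < k" "m \<in> block j k" "n \<in> block j k"
  shows "\<phi> (m \<ominus> n) = \<phi> m \<ominus> \<phi> n"
proof -
  have "\<ominus> n \<in> block j k"
    using block_minus[OF assms(1,2) zero_in_block[OF assms(1,2)] assms(5)] blockD[OF assms(5)]
    by (simp add: minus_eq)
  then show ?thesis
    using phi_add[OF assms(1-4)] phi_a_inv[OF assms(1-3,5)] by (simp add: minus_eq)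
qed

text \<open>As \<open>a\<close> commutes with \<open>block j j\<close> for \<open>j \<noteq> i\<close>, the entry of \<open>\<phi> a\<close> at \<open>j\<close> is central there, hence is
the entry of a central \<open>z\<close>.  The entries of \<open>\<phi> a\<close> at different indices other than \<open>i\<close> are linked by the blocks
between them in the same way as those of \<open>z\<close>, so one \<open>z\<close> serves all these indices at once.\<close>

lemma phi_diagonal_mod_center:
  assumes i: "i \<in> I" and a: "a \<in> block i i"
  shows "\<exists>z\<in>ring_center R. \<phi> a \<ominus> z \<in> block i i"
proof -
  have c: "a \<in> carrier R" "\<phi> a \<in> carrier R" using blockD[OF a] by auto
  have central: "entry j j (\<phi> a) \<otimes> b = b \<otimes> entry j j (\<phi> a)"
    if j: "j \<in> I" "j \<noteq> i" and b: "b \<in> block j j" for j b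
  proof -
    have cb: "b \<in> carrier R" using blockD[OF b] .
    have "br a b = \<zero>"
      using block_mult_zero[OF i i j(1) j(1) _ a b] block_mult_zero[OF j(1) j(1) i i _ b a] j
      by (simp add: lie_bracket_def)
    then have "\<zero> = br (\<phi> a) b \<oplus> br a (\<phi> b)"
      using phi_br[OF c(1) cb] by (simp add: phi_zero)
    then have "entry j j \<zero> = entry j j (br (\<phi> a) b) \<oplus> entry j j (br a (\<phi> b))"
      using c cb j by (simp add: entry_add[symmetric])
    moreover have "entry j j (br a (\<phi> b)) = \<zero>"
    proof -
      have "e j \<otimes> a = \<zero>" "a \<otimes> e j = \<zero>"
        using block_left[OF i i j(1) a] block_right[OF i i j(1) a] j by auto
      then have "e j \<otimes> (a \<otimes> \<phi> b) = \<zero>" "\<phi> b \<otimes> a \<otimes> e j = \<zero>"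
        using c cb j by (simp flip: m_assoc, simp add: m_assoc)
      then have "entry j j (a \<otimes> \<phi> b) = \<zero>" "entry j j (\<phi> b \<otimes> a) = \<zero>"
        using c cb j m_assoc[of "e j" "\<phi> b \<otimes> a" "e j"] by simp_all
      then show ?thesis using entry_br[OF j(1) j(1) c(1) phi_closed[OF cb]] by simp
    qed
    ultimately have "entry j j (\<phi> a) \<otimes> b \<ominus> b \<otimes> entry j j (\<phi> a) = \<zero>"
      using entry_br_block[OF j(1) j(1) b c(2)] c cb j by simp
    then show ?thesis using c cb j by simp
  qed
  have link: "entry j j (\<phi> a) \<otimes> m = m \<otimes> entry k k (\<phi> a)"
    if jk: "j \<in> I" "k \<in> I" "j < k" "j \<noteq> i" "k \<noteq> i" and m: "m \<in> block j k" for j k m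
  proof -
    have cm: "m \<in> carrier R" "\<phi> m \<in> carrier R" using blockD[OF m] by auto
    have "entry j j a = \<zero>" "entry k k a = \<zero>"
      using entry_of_block[OF i i _ _ a] jk by auto
    then have "\<zero> = (entry j j (\<phi> a) \<otimes> m \<ominus> m \<otimes> entry k k (\<phi> a)) \<oplus> \<zero>"
      using phi_action[OF jk(1-3) m c(1)] cm by (simp add: phi_zero)
    then show ?thesis
      by (rule cancel_difference[rotated 3]) (use c cm jk in simp_all)
  qed
  obtain j where j: "j \<in> I" "j \<noteq> i" using other_index[OF i] by auto
  obtain z where z: "z \<in> ring_center R" and zj: "entry j j z = entry j j (\<phi> a)"
    using center_lift[OF j(1) entry_in_block[OF j(1) j(1) c(2)] central[OF j]] by auto
  have zc: "z \<in> carrier R" using z by (simp add: in_center_iff)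
  have zk: "entry k k z = entry k k (\<phi> a)" if k: "k \<in> I" "k \<noteq> i" for k
  proof -
    have b: "entry k k z \<in> block k k" "entry k k (\<phi> a) \<in> block k k"
      using entry_in_block k zc c by auto
    consider "k = j" | "j < k" | "k < j" by fastforce
    then show ?thesis
    proof cases
      case 1 then show ?thesis using zj by simp
    next
      case 2
      show ?thesis
        by (rule right_faithful_eq[OF j(1) k(1) 2 b])
          (metis center_entry(2)[OF z j(1) k(1)] link[OF j(1) k(1) 2 j(2) k(2)] zj)
    next
      case 3
      show ?thesis
        by (rule left_faithful_eq[OF k(1) j(1) 3 b])
          (metis center_entry(2)[OF z k(1) j(1)] link[OF k(1) j(1) 3 k(2) j(2)] zj)
    qed
  qed
  have "\<phi> a \<ominus> z \<in> block i i"
  proof (rule blockI[OF i i])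
    show w: "\<phi> a \<ominus> z \<in> carrier R" using c zc by simp
    fix k l assume kl: "k \<in> I" "l \<in> I" "(k, l) \<noteq> (i, i)"
    consider "k = l" "k \<noteq> i" | "k < l" | "l < k" using kl(3) by fastforce
    then show "entry k l (\<phi> a \<ominus> z) = \<zero>"
    proof cases
      case 1 then show ?thesis using zk kl c zc by (simp add: entry_minus)
    next
      case 2
      have "entry k l (\<phi> a) = \<zero>"
        using phi_entry[OF kl(1,2) 2 c(1)] entry_of_block[OF i i kl(1,2) a] kl(3)
        by (auto simp: phi_zero)
      then show ?thesis using center_entry(1)[OF z kl(1,2)] 2 kl c zc by (simp add: entry_minus)
    next
      case 3 then show ?thesis using lower_zero kl w by simp
    qed
  qed
  then show ?thesis using z by auto
qed


section \<open>The derivation\<close>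

text \<open>The part of the derivation that lives on one block: \<open>\<phi>\<close> itself off the diagonal, and \<open>\<phi>\<close> corrected by a
central element on the diagonal.  The choice of the central element is harmless, since a central
element contained in a single diagonal block is zero.\<close>

definition D :: "'i \<Rightarrow> 'i \<Rightarrow> 'a \<Rightarrow> 'a" where
  "D i j x = (if i = j then \<phi> x \<ominus> (SOME z. z \<in> ring_center R \<and> \<phi> x \<ominus> z \<in> block i i) else \<phi> x)"

lemma D_off [simp]: "i \<noteq> j \<Longrightarrow> D i j x = \<phi> x"
  by (simp add: D_def)

lemma D_diag:
  assumes "i \<in> I" "a \<in> block i i"
  shows "D i i a \<in> block i i" "\<phi> a \<ominus> D i i a \<in> ring_center R"
proof -
  define z where "z = (SOME z. z \<in> ring_center R \<and> \<phi> a \<ominus> z \<in> block i i)"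
  have z: "z \<in> ring_center R" "\<phi> a \<ominus> z \<in> block i i"
    using someI_ex[of "\<lambda>z. z \<in> ring_center R \<and> \<phi> a \<ominus> z \<in> block i i"] phi_diagonal_mod_center[OF assms]
    unfolding z_def by auto
  have D: "D i i a = \<phi> a \<ominus> z" by (simp add: D_def z_def)
  then show "D i i a \<in> block i i" using z by simp
  have "\<phi> a \<in> carrier R" "z \<in> carrier R"
    using z blockD[OF assms(2)] by (auto simp: in_center_iff)
  then have "\<phi> a \<ominus> (\<phi> a \<ominus> z) = z" by algebra
  then show "\<phi> a \<ominus> D i i a \<in> ring_center R" using z D by simp
qed

lemma D_block:
  assumes "i \<in> I" "j \<in> I" "x \<in> block i j"
  shows "D i j x \<in> block i j"
proof -
  consider "i = j" | "i < j" | "j < i" by fastforce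
  then show ?thesis
  proof cases
    case 3
    then show ?thesis using block_lower[OF assms(1,2) _ assms(3)] zero_in_block[OF assms(1,2)]
      by (simp add: phi_zero)
  qed (use D_diag assms phi_block in auto)
qed

text \<open>Inside brackets \<open>\<phi>\<close> may be replaced by \<open>D\<close>, because they differ by a central element.\<close>

lemma br_D:
  assumes ij: "i \<in> I" "j \<in> I" and x: "x \<in> block i j" and y: "y \<in> carrier R"
  shows "br (\<phi> x) y = br (D i j x) y" "br y (\<phi> x) = br y (D i j x)"
proof -
  have c: "\<phi> x \<in> carrier R" "D i j x \<in> carrier R"
    using blockD[OF x] blockD[OF D_block[OF ij x]] by auto
  have "\<phi> x \<ominus> D i j x \<in> ring_center R"
  proof (cases "i = j")
    case True then show ?thesis using D_diag ij x by auto
  next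
    case False
    then have "\<phi> x \<ominus> D i j x = \<zero>" using c by simp
    then show ?thesis by (simp add: in_center_iff)
  qed
  from br_center[OF this y] show "br (\<phi> x) y = br (D i j x) y" "br y (\<phi> x) = br y (D i j x)"
    using c y by (simp_all add: br_minus_left br_minus_right)
qed

text \<open>For \<open>i \<noteq> k\<close> the products in the opposite order vanish, so \<open>x y = [x, y]\<close> and the Leibniz rule is the Lie identity.\<close>

lemma D_mult_off:
  assumes I: "i \<in> I" "j \<in> I" "k \<in> I" and "i \<noteq> k" and x: "x \<in> block i j" and y: "y \<in> block j k"
  shows "D i k (x \<otimes> y) = D i j x \<otimes> y \<oplus> x \<otimes> D j k y"
proof -
  have Dx: "D i j x \<in> block i j" and Dy: "D j k y \<in> block j k"
    using D_block I x y by auto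
  note c = blockD[OF x] blockD[OF y] blockD[OF Dx] blockD[OF Dy]
  have zero: "y \<otimes> x = \<zero>" "y \<otimes> D i j x = \<zero>" "D j k y \<otimes> x = \<zero>"
    using block_mult_zero[OF I(2,3,1,2)] assms(4) x y Dx Dy by auto
  have "D i k (x \<otimes> y) = \<phi> (br x y)"
    using c zero assms(4) by (simp add: lie_bracket_def)
  also have "\<dots> = br (D i j x) y \<oplus> br x (D j k y)"
    using c phi_br br_D[OF I(1,2) x c(2)] br_D[OF I(2,3) y c(1)] by simp
  also have "\<dots> = D i j x \<otimes> y \<oplus> x \<otimes> D j k y"
    using c zero by (simp add: lie_bracket_def)
  finally show ?thesis .
qed

text \<open>On a diagonal block, expand \<open>D ((x + y) m)\<close> for \<open>m\<close> in an off-diagonal block in two ways and cancel \<open>m\<close> by faithfulness.\<close>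

lemma D_add:
  assumes ij: "i \<in> I" "j \<in> I" and x: "x \<in> block i j" and y: "y \<in> block i j"
  shows "D i j (x \<oplus> y) = D i j x \<oplus> D i j y"
proof -
  note xy = block_add[OF ij x y]
  note Dx = D_block[OF ij x] and Dy = D_block[OF ij y] and Dxy = D_block[OF ij xy]
  note c = blockD[OF x] blockD[OF y] blockD[OF Dx] blockD[OF Dy] blockD[OF Dxy]
  consider "i = j" | "i < j" | "j < i" by fastforce
  then show ?thesis
  proof cases
    case 2
    then show ?thesis using phi_add[OF ij 2 x y] by simp
  next
    case 3
    then show ?thesis
      using block_lower[OF ij 3 Dxy] block_lower[OF ij 3 Dx] block_lower[OF ij 3 Dy] by simp
  next
    case 1
    note b = xy[folded 1] x[folded 1] y[folded 1]
    note Db = Dxy[folded 1] Dx[folded 1] Dy[folded 1]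
    note sumb = block_add[OF ij(1) ij(1) Db(2,3)]
    obtain l where l: "l \<in> I" "l \<noteq> i" using other_index[OF ij(1)] by auto
    consider "i < l" | "l < i" using l(2) by fastforce
    then have "D i i (x \<oplus> y) = D i i x \<oplus> D i i y"
    proof cases
      case 1
      show ?thesis
      proof (rule left_faithful_eq[OF ij(1) l(1) 1 Db(1) sumb])
        fix m assume m: "m \<in> block i l"
        note cm = blockD[OF m] blockD[OF D_block[OF ij(1) l(1) m]]
        note leib = D_mult_off[OF ij(1) ij(1) l(1) l(2)[symmetric] _ m]
        note xm = block_mult[OF ij(1) ij(1) l(1) b(2) m] and ym = block_mult[OF ij(1) ij(1) l(1) b(3) m]
        have "D i i (x \<oplus> y) \<otimes> m \<oplus> (x \<oplus> y) \<otimes> D i l m = D i l ((x \<oplus> y) \<otimes> m)"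
          using leib[OF b(1)] by simp
        also have "\<dots> = D i l (x \<otimes> m) \<oplus> D i l (y \<otimes> m)"
          using phi_add[OF ij(1) l(1) 1 xm ym] l c cm by (simp add: l_distr)
        also have "\<dots> = (D i i x \<oplus> D i i y) \<otimes> m \<oplus> (x \<oplus> y) \<otimes> D i l m"
          using c cm blockD[OF Db(2)] blockD[OF Db(3)] leib[OF b(2)] leib[OF b(3)]
          by (simp add: l_distr a_ac)
        finally show "D i i (x \<oplus> y) \<otimes> m = (D i i x \<oplus> D i i y) \<otimes> m"
          using c cm blockD[OF Db(1)] blockD[OF sumb] by (simp add: add.m_closed)
      qed
    next
      case 2
      show ?thesis
      proof (rule right_faithful_eq[OF l(1) ij(1) 2 Db(1) sumb])
        fix m assume m: "m \<in> block l i"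
        note cm = blockD[OF m] blockD[OF D_block[OF l(1) ij(1) m]]
        note leib = D_mult_off[OF l(1) ij(1) ij(1) l(2) m]
        note xm = block_mult[OF l(1) ij(1) ij(1) m b(2)] and ym = block_mult[OF l(1) ij(1) ij(1) m b(3)]
        have "D l i m \<otimes> (x \<oplus> y) \<oplus> m \<otimes> D i i (x \<oplus> y) = D l i (m \<otimes> (x \<oplus> y))"
          using leib[OF b(1)] by simp
        also have "\<dots> = D l i (m \<otimes> x) \<oplus> D l i (m \<otimes> y)"
          using phi_add[OF l(1) ij(1) 2 xm ym] l c cm by (simp add: r_distr)
        also have "\<dots> = D l i m \<otimes> (x \<oplus> y) \<oplus> m \<otimes> (D i i x \<oplus> D i i y)"
          using c cm blockD[OF Db(2)] blockD[OF Db(3)] leib[OF b(2)] leib[OF b(3)]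
          by (simp add: r_distr a_ac)
        finally show "m \<otimes> D i i (x \<oplus> y) = m \<otimes> (D i i x \<oplus> D i i y)"
          using c cm blockD[OF Db(1)] blockD[OF sumb] by simp
      qed
    qed
    then show ?thesis using 1 by simp
  qed
qed

lemma D_zero:
  assumes "i \<in> I" "j \<in> I"
  shows "D i j \<zero> = \<zero>"
  using D_add[OF assms zero_in_block[OF assms] zero_in_block[OF assms]]
    blockD[OF D_block[OF assms zero_in_block[OF assms]]]
  by simp

text \<open>For \<open>i = k \<noteq> j\<close> one of the factors lies below the diagonal.  On a diagonal block, expand \<open>D (x y m)\<close> in two
ways and cancel \<open>m\<close> by faithfulness.\<close>

lemma D_mult:
  assumes I: "i \<in> I" "j \<in> I" "k \<in> I" and x: "x \<in> block i j" and y: "y \<in> block j k"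
  shows "D i k (x \<otimes> y) = D i j x \<otimes> y \<oplus> x \<otimes> D j k y"
proof -
  note xy = block_mult[OF I x y]
  note Dx = D_block[OF I(1,2) x] and Dy = D_block[OF I(2,3) y] and Dxy = D_block[OF I(1,3) xy]
  note Dxy' = block_add[OF I(1,3) block_mult[OF I Dx y] block_mult[OF I x Dy]]
  note c = blockD[OF x] blockD[OF y] blockD[OF Dx] blockD[OF Dy] blockD[OF Dxy] blockD[OF Dxy']
  consider "i \<noteq> k" | "i = k" "j \<noteq> i" | "i = j" "j = k" by auto
  then show ?thesis
  proof cases
    case 1 then show ?thesis using D_mult_off[OF I 1 x y] by simp
  next
    case 2
    then consider "j < i" | "k < j" by fastforce
    then show ?thesis
    proof cases
      case 1
      then have "x = \<zero>" "D i j x = \<zero>"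
        using block_lower[OF I(1,2) 1] x Dx by auto
      then show ?thesis using c D_zero I by simp
    next
      case 2
      then have "y = \<zero>" "D j k y = \<zero>"
        using block_lower[OF I(2,3) 2] y Dy by auto
      then show ?thesis using c D_zero I by simp
    qed
  next
    case 3
    have x: "x \<in> block i i" and y: "y \<in> block i i" using x y 3 by auto
    have Dx: "D i i x \<in> block i i" and Dy: "D i i y \<in> block i i"
      and Dxy: "D i i (x \<otimes> y) \<in> block i i"
      and Dxy': "D i i x \<otimes> y \<oplus> x \<otimes> D i i y \<in> block i i" and xy: "x \<otimes> y \<in> block i i"
      using Dx Dy Dxy Dxy' xy 3 by auto
    note i = I(1)
    note c = blockD[OF x] blockD[OF y] blockD[OF Dx] blockD[OF Dy] blockD[OF Dxy] blockD[OF Dxy']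
    obtain l where l: "l \<in> I" "l \<noteq> i" using other_index[OF i] by auto
    consider "i < l" | "l < i" using l(2) by fastforce
    then have "D i i (x \<otimes> y) = D i i x \<otimes> y \<oplus> x \<otimes> D i i y"
    proof cases
      case 1
      show ?thesis
      proof (rule left_faithful_eq[OF i l(1) 1 Dxy Dxy'])
        fix m assume m: "m \<in> block i l"
        note cm = blockD[OF m] blockD[OF D_block[OF i l(1) m]]
        note leib = D_mult_off[OF i i l(1) l(2)[symmetric]]
        have "D i i (x \<otimes> y) \<otimes> m \<oplus> x \<otimes> y \<otimes> D i l m = D i l (x \<otimes> (y \<otimes> m))"
          using leib[OF xy m] c cm by (simp add: m_assoc)
        also have "\<dots> = D i i x \<otimes> (y \<otimes> m) \<oplus> x \<otimes> (D i i y \<otimes> m \<oplus> y \<otimes> D i l m)"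
          using leib[OF x block_mult[OF i i l(1) y m]] leib[OF y m] by simp
        also have "\<dots> = (D i i x \<otimes> y \<oplus> x \<otimes> D i i y) \<otimes> m \<oplus> x \<otimes> y \<otimes> D i l m"
          using c cm by (simp add: l_distr r_distr m_assoc a_assoc)
        finally show "D i i (x \<otimes> y) \<otimes> m = (D i i x \<otimes> y \<oplus> x \<otimes> D i i y) \<otimes> m"
          using c cm by simp
      qed
    next
      case 2
      show ?thesis
      proof (rule right_faithful_eq[OF l(1) i 2 Dxy Dxy'])
        fix m assume m: "m \<in> block l i"
        note cm = blockD[OF m] blockD[OF D_block[OF l(1) i m]]
        note leib = D_mult_off[OF l(1) i i l(2)]
        have "D l i m \<otimes> (x \<otimes> y) \<oplus> m \<otimes> D i i (x \<otimes> y) = D l i (m \<otimes> x \<otimes> y)"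
          using leib[OF m xy] c cm by (simp add: m_assoc)
        also have "\<dots> = (D l i m \<otimes> x \<oplus> m \<otimes> D i i x) \<otimes> y \<oplus> m \<otimes> x \<otimes> D i i y"
          using leib[OF block_mult[OF l(1) i i m x] y] leib[OF m x] by simp
        also have "\<dots> = D l i m \<otimes> (x \<otimes> y) \<oplus> m \<otimes> (D i i x \<otimes> y \<oplus> x \<otimes> D i i y)"
          using c cm by (simp add: l_distr r_distr m_assoc a_assoc)
        finally show "m \<otimes> D i i (x \<otimes> y) = m \<otimes> (D i i x \<otimes> y \<oplus> x \<otimes> D i i y)"
          using c cm by simp
      qed
    qed
    then show ?thesis using 3 by simp
  qed
qed

lemma D_finsum:
  assumes ij: "i \<in> I" "j \<in> I" and "finite K" "\<And>k. k \<in> K \<Longrightarrow> g k \<in> block i j"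
  shows "(\<Oplus>k\<in>K. g k) \<in> block i j \<and> D i j (\<Oplus>k\<in>K. g k) = (\<Oplus>k\<in>K. D i j (g k))"
  using assms(3,4)
proof (induction K rule: finite_induct)
  case empty
  then show ?case using D_zero[OF ij] zero_in_block[OF ij] by simp
next
  case (insert k K)
  have g: "g l \<in> block i j" if "l \<in> insert k K" for l using insert.prems that .
  have IH: "(\<Oplus>k\<in>K. g k) \<in> block i j" "D i j (\<Oplus>k\<in>K. g k) = (\<Oplus>k\<in>K. D i j (g k))"
    using insert.IH g by auto
  have "g \<in> K \<rightarrow> carrier R" "g k \<in> carrier R"
    using blockD[OF g] by auto
  then have sum: "(\<Oplus>k\<in>insert k K. g k) = g k \<oplus> (\<Oplus>k\<in>K. g k)"
    using insert.hyps by (intro finsum_insert)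
  have "(\<lambda>k. D i j (g k)) \<in> K \<rightarrow> carrier R" "D i j (g k) \<in> carrier R"
    using blockD[OF D_block[OF ij g]] by auto
  then have "(\<Oplus>k\<in>insert k K. D i j (g k)) = D i j (g k) \<oplus> (\<Oplus>k\<in>K. D i j (g k))"
    using insert.hyps by (intro finsum_insert)
  then show ?case
    using sum IH D_add[OF ij g IH(1)] block_add[OF ij g IH(1)] by simp
qed

definition \<delta> :: "'a \<Rightarrow> 'a" where
  "\<delta> x = (\<Oplus>i\<in>I. \<Oplus>j\<in>I. D i j (entry i j x))"

lemma delta:
  assumes x: "x \<in> carrier R"
  shows delta_closed: "\<delta> x \<in> carrier R"
    and entry_delta: "\<And>i j. i \<in> I \<Longrightarrow> j \<in> I \<Longrightarrow> entry i j (\<delta> x) = D i j (entry i j x)"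
  using entries_assemble[of "\<lambda>i j. D i j (entry i j x)"] D_block entry_in_block x
  unfolding \<delta>_def by auto

lemma delta_derivation: "ring_derivation R \<delta>"
  unfolding ring_derivation_def
proof (intro conjI ballI)
  show "\<delta> \<in> carrier R \<rightarrow> carrier R" by (auto simp: delta_closed)
  fix x y assume c: "x \<in> carrier R" "y \<in> carrier R"
  note dc = delta_closed[OF c(1)] delta_closed[OF c(2)]
  show "\<delta> (x \<oplus> y) = \<delta> x \<oplus> \<delta> y"
  proof (rule entry_ext)
    fix i j assume ij: "i \<in> I" "j \<in> I"
    have "entry i j (\<delta> (x \<oplus> y)) = D i j (entry i j x \<oplus> entry i j y)"
      using entry_delta[OF a_closed[OF c] ij] entry_add[OF ij c] by simp
    also have "\<dots> = entry i j (\<delta> x) \<oplus> entry i j (\<delta> y)"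
      using D_add[OF ij entry_in_block[OF ij c(1)] entry_in_block[OF ij c(2)]]
        entry_delta[OF c(1) ij] entry_delta[OF c(2) ij] by simp
    finally show "entry i j (\<delta> (x \<oplus> y)) = entry i j (\<delta> x \<oplus> \<delta> y)"
      using entry_add[OF ij dc] by simp
  qed (use c dc delta_closed in simp_all)
  show "\<delta> (x \<otimes> y) = \<delta> x \<otimes> y \<oplus> x \<otimes> \<delta> y"
  proof (rule entry_ext)
    fix i j assume ij: "i \<in> I" "j \<in> I"
    have b: "entry i k x \<in> block i k" "entry k j y \<in> block k j"
      "D i k (entry i k x) \<in> block i k" "D k j (entry k j y) \<in> block k j" if "k \<in> I" for k
      using D_block[OF ij(1) that] D_block[OF that ij(2)]
        entry_in_block[OF ij(1) that c(1)] entry_in_block[OF that ij(2) c(2)] by simp_all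
    note bc = b[THEN blockD]
    have "entry i j (\<delta> (x \<otimes> y)) = D i j (\<Oplus>k\<in>I. entry i k x \<otimes> entry k j y)"
      using entry_delta[OF m_closed[OF c] ij] entry_mult[OF ij c] by simp
    also have "\<dots> = (\<Oplus>k\<in>I. D i j (entry i k x \<otimes> entry k j y))"
      by (rule conjunct2[OF D_finsum[OF ij finite_I]]) (rule block_mult[OF ij(1) _ ij(2) b(1,2)])
    also have "\<dots> = (\<Oplus>k\<in>I. D i k (entry i k x) \<otimes> entry k j y \<oplus> entry i k x \<otimes> D k j (entry k j y))"
      using D_mult[OF ij(1) _ ij(2) b(1,2)] bc
      by (intro finsum_cong) (simp_all add: simp_implies_def)
    also have "\<dots> = (\<Oplus>k\<in>I. D i k (entry i k x) \<otimes> entry k j y) \<oplus>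
        (\<Oplus>k\<in>I. entry i k x \<otimes> D k j (entry k j y))"
      using bc by (intro finsum_addf) auto
    also have "(\<Oplus>k\<in>I. D i k (entry i k x) \<otimes> entry k j y) = (\<Oplus>k\<in>I. entry i k (\<delta> x) \<otimes> entry k j y)"
      using bc entry_delta[OF c(1) ij(1)] by (intro finsum_cong) (simp_all add: simp_implies_def)
    also have "\<dots> = entry i j (\<delta> x \<otimes> y)"
      using entry_mult[OF ij dc(1) c(2)] by simp
    also have "(\<Oplus>k\<in>I. entry i k x \<otimes> D k j (entry k j y)) = (\<Oplus>k\<in>I. entry i k x \<otimes> entry k j (\<delta> y))"
      using bc entry_delta[OF c(2) _ ij(2)] by (intro finsum_cong) (simp_all add: simp_implies_def)
    also have "\<dots> = entry i j (x \<otimes> \<delta> y)"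
      using entry_mult[OF ij c(1) dc(2)] by simp
    finally show "entry i j (\<delta> (x \<otimes> y)) = entry i j (\<delta> x \<otimes> y \<oplus> x \<otimes> \<delta> y)"
      using entry_add[OF ij m_closed[OF dc(1) c(2)] m_closed[OF c(1) dc(2)]] by simp
  qed (use c dc delta_closed in simp_all)
qed

text \<open>Off the diagonal \<open>\<phi>\<close> and \<open>\<delta>\<close> agree by \<open>phi_entry\<close>.  For the diagonal, \<open>phi_action\<close> and the Leibniz rule
for \<open>D\<close> describe the diagonal entries of \<open>\<phi> x\<close> and of \<open>\<delta> x\<close> by the same equation, so that their difference commutes
with every off-diagonal block.\<close>

lemma remainder_central:
  assumes x: "x \<in> carrier R"
  shows "\<phi> x \<ominus> \<delta> x \<in> ring_center R"
proof (rule centerI)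
  note dx = delta_closed[OF x]
  show "\<phi> x \<ominus> \<delta> x \<in> carrier R" using x dx by simp
  fix j k assume jk: "j \<in> I" "k \<in> I" "j < k"
  show "entry j k (\<phi> x \<ominus> \<delta> x) = \<zero>"
    using phi_entry[OF jk x] entry_delta[OF x jk(1,2)] jk(3) x dx jk by (simp add: entry_minus)
  fix m assume m: "m \<in> block j k"
  have ne: "j \<noteq> k" using jk(3) by simp
  let ?a = "entry j j x" and ?b = "entry k k x"
  have a: "?a \<in> block j j" and b: "?b \<in> block k k"
    using x jk entry_in_block by auto
  note Dm = D_block[OF jk(1,2) m] and Da = D_block[OF jk(1) jk(1) a] and Db = D_block[OF jk(2) jk(2) b]
  note am = block_mult[OF jk(1) jk(1,2) a m] and mb = block_mult[OF jk(1,2) jk(2) m b]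
  note c = blockD[OF m] blockD[OF a] blockD[OF b] blockD[OF Da] blockD[OF Db]
  have cm: "\<phi> m \<in> carrier R" using c by simp
  define p q where "p = entry j j (\<phi> x)" and "q = entry k k (\<phi> x)"
  have pq: "p \<in> carrier R" "q \<in> carrier R" using x jk by (auto simp: p_def q_def)
  have "(p \<otimes> m \<ominus> m \<otimes> q) \<oplus> (?a \<otimes> \<phi> m \<ominus> \<phi> m \<otimes> ?b) = \<phi> (?a \<otimes> m \<ominus> m \<otimes> ?b)"
    using phi_action[OF jk m x] by (simp add: p_def q_def)
  also have "\<dots> = \<phi> (?a \<otimes> m) \<ominus> \<phi> (m \<otimes> ?b)"
    by (rule phi_minus[OF jk am mb])
  also have "\<dots> = (D j j ?a \<otimes> m \<oplus> ?a \<otimes> \<phi> m) \<ominus> (\<phi> m \<otimes> ?b \<oplus> m \<otimes> D k k ?b)"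
    using D_mult[OF jk(1) jk(1,2) a m] D_mult[OF jk(1,2) jk(2) m b] ne by simp
  finally have eq: "(p \<otimes> m \<ominus> m \<otimes> q) \<oplus> (?a \<otimes> \<phi> m \<ominus> \<phi> m \<otimes> ?b) =
      (D j j ?a \<otimes> m \<oplus> ?a \<otimes> \<phi> m) \<ominus> (\<phi> m \<otimes> ?b \<oplus> m \<otimes> D k k ?b)" .
  have regroup: "(P \<ominus> Q) \<oplus> (A \<ominus> B) = (P' \<oplus> A) \<ominus> (B \<oplus> Q') \<Longrightarrow> P \<ominus> P' = Q \<ominus> Q'"
    if cl: "P \<in> carrier R" "Q \<in> carrier R" "A \<in> carrier R" "B \<in> carrier R" "P' \<in> carrier R"
      "Q' \<in> carrier R" for P Q A B P' Q'
  proof -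
    assume h: "(P \<ominus> Q) \<oplus> (A \<ominus> B) = (P' \<oplus> A) \<ominus> (B \<oplus> Q')"
    have "(P' \<oplus> A) \<ominus> (B \<oplus> Q') = (P' \<ominus> Q') \<oplus> (A \<ominus> B)"
      using cl by algebra
    then have PQ: "P \<ominus> Q = P' \<ominus> Q'"
      using h cl by simp
    have "P = (P \<ominus> Q) \<oplus> Q" by (rule diff_add_cancel[symmetric, OF cl(1,2)])
    also have "\<dots> = (Q \<ominus> Q') \<oplus> P'" unfolding PQ using cl by algebra
    finally have "P \<ominus> P' = ((Q \<ominus> Q') \<oplus> P') \<ominus> P'" by simp
    also have "\<dots> = Q \<ominus> Q'" using cl by (simp add: minus_eq a_assoc r_neg)
    finally show "P \<ominus> P' = Q \<ominus> Q'" .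
  qed
  have "p \<otimes> m \<ominus> D j j ?a \<otimes> m = m \<otimes> q \<ominus> m \<otimes> D k k ?b"
    using regroup[OF _ _ _ _ _ _ eq] c cm pq by simp
  then have "(p \<ominus> D j j ?a) \<otimes> m = m \<otimes> (q \<ominus> D k k ?b)"
    using c pq by (simp add: minus_eq l_distr r_distr l_minus r_minus)
  then show "entry j j (\<phi> x \<ominus> \<delta> x) \<otimes> m = m \<otimes> entry k k (\<phi> x \<ominus> \<delta> x)"
    using jk x dx by (simp add: entry_minus entry_delta p_def q_def)
qed

end

text \<open>Since \<open>\<phi>\<close> and \<open>\<delta>\<close> differ by central elements and both satisfy the Lie identity, they agree on brackets.\<close>

lemma (in normalized_lie_derivation) remainder_br:
  assumes x: "x \<in> carrier R" and y: "y \<in> carrier R"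
  shows "\<phi> (br x y) \<ominus> \<delta> (br x y) = \<zero>"
proof -
  have eq: "br (\<phi> u) v = br (\<delta> u) v" "br v (\<phi> u) = br v (\<delta> u)"
    if uv: "u \<in> carrier R" "v \<in> carrier R" for u v
    using br_center[OF remainder_central[OF uv(1)] uv(2)] delta_closed[OF uv(1)] uv
    by (simp_all add: br_minus_left br_minus_right)
  have "\<phi> (br x y) = \<delta> (br x y)"
    using phi_br[OF x y] derivation_br[OF delta_derivation x y] eq[OF x y] eq[OF y x] by simp
  then show ?thesis using x y delta_closed[of "br x y"] by simp
qed

text \<open>Reduction to the normalized case.  The entries of \<open>\<phi> (e i)\<close> above the diagonal are the ones
of \<open>[n, e i]\<close>: in column \<open>i\<close> they are those of \<open>n\<close> by definition, in row \<open>i\<close> their negatives by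
\<open>\<phi> [e i, e k] = 0\<close>, and all others vanish for the same reason.\<close>

theorem (in triangular_idempotents) mult_lie_derivation_decomposition:
  assumes phi: "mult_lie_derivation R \<phi>"
    and center_lift: "\<And>i c. i \<in> I \<Longrightarrow> c \<in> block i i \<Longrightarrow>
      (\<And>a. a \<in> block i i \<Longrightarrow> c \<otimes> a = a \<otimes> c) \<Longrightarrow> \<exists>z\<in>ring_center R. entry i i z = c"
  shows "\<exists>d \<gamma>. ring_derivation R d \<and>
           \<gamma> \<in> carrier R \<rightarrow> ring_center R \<and>
           (\<forall>x \<in> carrier R. \<forall>y \<in> carrier R. \<gamma> (lie_bracket R x y) = \<zero>) \<and>
           (\<forall>x \<in> carrier R. \<phi> x = d x \<oplus> \<gamma> x)"
proof -
  have pc: "\<phi> x \<in> carrier R" if "x \<in> carrier R" for x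
    using phi that by (auto simp: mult_lie_derivation_def)
  define n where "n = (\<Oplus>k\<in>I. \<Oplus>l\<in>I. entry k l (\<phi> (e l)))"
  have en: "entry k l n = entry k l (\<phi> (e l))" if "k \<in> I" "l \<in> I" for k l
    using entries_assemble[of "\<lambda>k l. entry k l (\<phi> (e l))"] entry_in_block pc that unfolding n_def by auto
  have n: "n \<in> carrier R"
    unfolding n_def by (intro finsum_closed) (auto intro!: finsum_closed pc)
  define \<psi> where "\<psi> = (\<lambda>x. \<phi> x \<ominus> br n x)"
  have "entry j k (\<psi> (e i)) = \<zero>" if I: "i \<in> I" "j \<in> I" "k \<in> I" and "j < k" for i j k
  proof -
    note c = pc[OF e_closed[OF I(1)]] pc[OF e_closed[OF I(3)]]
    have ne: "j \<noteq> k" using \<open>j < k\<close> by simp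
    have "entry j k (\<psi> (e i)) = entry j k (\<phi> (e i)) \<ominus>
        ((if i = k then entry j k (\<phi> (e k)) else \<zero>) \<ominus> (if i = j then entry j k (\<phi> (e k)) else \<zero>))"
      using c n I by (simp add: \<psi>_def entry_minus entry_br_idem_right en)
    also have "\<dots> = \<zero>"
    proof (cases "i = k")
      case True then show ?thesis using c I ne by simp
    next
      case False
      then have "br (e i) (e k) = \<zero>" using I e_mult by (simp add: lie_bracket_def)
      then have "\<zero> = br (\<phi> (e i)) (e k) \<oplus> br (e i) (\<phi> (e k))"
        using phi I lie_derivation_zero[OF phi] by (metis e_closed mult_lie_derivation_def)
      then have "entry j k \<zero> = entry j k (br (\<phi> (e i)) (e k)) \<oplus> entry j k (br (e i) (\<phi> (e k)))"
        using c I by (simp add: entry_add[symmetric])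
      then have sum: "entry j k (\<phi> (e i)) \<oplus> (if i = j then entry j k (\<phi> (e k)) else \<zero>) = \<zero>"
        using entry_br_idem_right[OF I(3,2,3) c(1)] entry_br_idem[OF I(1,2,3) c(2)] False ne c I by simp
      show ?thesis
      proof (cases "i = j")
        case True
        have "entry j k (\<phi> (e i)) \<ominus> (\<zero> \<ominus> entry j k (\<phi> (e k))) = entry j k (\<phi> (e i)) \<oplus> entry j k (\<phi> (e k))"
          using c I by (simp add: minus_eq)
        then show ?thesis using sum True ne by simp
      qed (use sum False c I in simp)
    qed
    finally show ?thesis .
  qed
  then interpret N: normalized_lie_derivation R I e \<psi>
    using subtract_inner_derivation[OF phi n] center_lift
    by unfold_locales (auto simp: \<psi>_def)
  have "\<phi> x = (N.\<delta> x \<oplus> br n x) \<oplus> (\<psi> x \<ominus> N.\<delta> x)" if x: "x \<in> carrier R" for x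
  proof -
    have c: "\<psi> x \<in> carrier R" "N.\<delta> x \<in> carrier R" "br n x \<in> carrier R"
      using pc[OF x] n x N.delta_closed[OF x] by (simp_all add: \<psi>_def)
    have "\<phi> x = \<psi> x \<oplus> br n x"
      unfolding \<psi>_def by (rule diff_add_cancel[symmetric]) (use pc[OF x] n x in simp_all)
    also have "\<psi> x = (\<psi> x \<ominus> N.\<delta> x) \<oplus> N.\<delta> x"
      by (rule diff_add_cancel[symmetric, OF c(1,2)])
    finally show ?thesis
      using c by (simp add: a_ac)
  qed
  moreover have "ring_derivation R (\<lambda>x. N.\<delta> x \<oplus> br n x)"
    by (rule derivation_add[OF N.delta_derivation inner_derivation[OF n]])
  ultimately show ?thesis
    using N.remainder_central N.remainder_br
    by (intro exI[of _ "\<lambda>x. N.\<delta> x \<oplus> br n x"] exI[of _ "\<lambda>x. \<psi> x \<ominus> N.\<delta> x"]) auto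
qed


section \<open>Triangular 3-matrix rings\<close>

text \<open>Negation in the corner ring is defined by a description over the smaller carrier; it is only needed that
\<open>d - d = 0\<close> there, which follows from the unique existence of additive inverses in \<open>p R p\<close>.\<close>

lemma corner_center:
  fixes R :: "'a ring" (structure)
  assumes "ring R" and p: "p \<in> carrier R" "p \<otimes> p = p"
    and c: "c \<in> peirce R p p" and comm: "\<And>a. a \<in> peirce R p p \<Longrightarrow> c \<otimes> a = a \<otimes> c"
  shows "c \<in> ring_center (corner_ring R p)"
proof -
  interpret ring R by fact
  let ?S = "corner_ring R p"
  have pp: "p \<otimes> (p \<otimes> x) = p \<otimes> x" if "x \<in> carrier R" for x
    using p that by (simp flip: m_assoc)
  have S: "carrier ?S = peirce R p p"
  proof
    show "carrier ?S \<subseteq> peirce R p p"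
      using p by (auto simp: corner_ring_def peirce_def m_assoc pp)
    show "peirce R p p \<subseteq> carrier ?S"
      by (auto simp: corner_ring_def peirce_def) (metis image_eqI)
  qed
  have cancel: "d \<ominus>\<^bsub>?S\<^esub> d = \<zero>\<^bsub>?S\<^esub>" if d: "d \<in> peirce R p p" for d
  proof -
    have dc: "d \<in> carrier R" using d by (simp add: peirce_def)
    have "\<exists>!y. y \<in> peirce R p p \<and> d \<oplus> y = \<zero> \<and> y \<oplus> d = \<zero>"
    proof (rule ex1I[of _ "\<ominus> d"])
      have "p \<otimes> (\<ominus> d) \<otimes> p = \<ominus> (p \<otimes> d \<otimes> p)" using p dc by algebra
      then show "\<ominus> d \<in> peirce R p p \<and> d \<oplus> \<ominus> d = \<zero> \<and> \<ominus> d \<oplus> d = \<zero>"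
        using d dc by (simp add: peirce_def r_neg l_neg)
    next
      fix y assume "y \<in> peirce R p p \<and> d \<oplus> y = \<zero> \<and> y \<oplus> d = \<zero>"
      then show "y = \<ominus> d" using dc by (metis (no_types, lifting) minus_equality mem_Collect_eq peirce_def)
    qed
    from theI'[OF this]
    show ?thesis
      using S by (simp add: a_minus_def a_inv_def m_inv_def corner_ring_def)
  qed
  have mult: "x \<otimes> y \<in> peirce R p p" if "x \<in> peirce R p p" "y \<in> peirce R p p" for x y
  proof -
    have "x \<in> carrier R" "y \<in> carrier R" "p \<otimes> x \<otimes> p = x" "p \<otimes> y \<otimes> p = y"
      using that by (auto simp: peirce_def)
    then have "p \<otimes> x = x" "y \<otimes> p = y"
      using p by (metis m_assoc m_closed, metis m_assoc m_closed)
    then show ?thesis using p \<open>x \<in> carrier R\<close> \<open>y \<in> carrier R\<close>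
      by (simp add: peirce_def m_assoc) (simp flip: m_assoc)
  qed
  have "lie_bracket ?S c a = \<zero>\<^bsub>?S\<^esub>" if a: "a \<in> peirce R p p" for a
  proof -
    have "c \<otimes>\<^bsub>?S\<^esub> a = c \<otimes> a" "a \<otimes>\<^bsub>?S\<^esub> c = c \<otimes> a"
      using comm[OF a] by (simp_all add: corner_ring_def)
    then show ?thesis using cancel[OF mult[OF c a]] by (simp add: lie_bracket_def)
  qed
  then show ?thesis using c S by (simp add: ring_center_def)
qed

context triangular3
begin

abbreviation "T \<equiv> tri_ring R1 R2 R3 M12 M13 M23 f"
abbreviation "Q \<equiv> tri_idem R1 R2 R3 M12 M13 M23"

lemmas tri_simps = tri_carrier tri_mult tri_add tri_zero tri_one
  M12.closed M13.closed M23.closed prod123(1)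
  M12.zeros M13.zeros M23.zeros prod123_zero
  M12.lact_one M13.lact_one M23.lact_one M12.ract_one M13.ract_one M23.ract_one

lemma Q_entry:
  assumes "i \<in> {1, 2, 3}" "j \<in> {1, 2, 3}" "Tri a x z b y c \<in> carrier T"
  shows "Q i \<otimes>\<^bsub>T\<^esub> Tri a x z b y c \<otimes>\<^bsub>T\<^esub> Q j =
    Tri (if i = 1 \<and> j = 1 then a else \<zero>\<^bsub>R1\<^esub>) (if i = 1 \<and> j = 2 then x else \<zero>\<^bsub>M12\<^esub>)
      (if i = 1 \<and> j = 3 then z else \<zero>\<^bsub>M13\<^esub>) (if i = 2 \<and> j = 2 then b else \<zero>\<^bsub>R2\<^esub>)
      (if i = 2 \<and> j = 3 then y else \<zero>\<^bsub>M23\<^esub>) (if i = 3 \<and> j = 3 then c else \<zero>\<^bsub>R3\<^esub>)"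
  using assms by (auto simp: tri_idem_def tri_simps)

lemma Q_peirce:
  assumes "i \<in> {1, 2, 3}" "j \<in> {1, 2, 3}"
  shows "Tri a x z b y c \<in> peirce T (Q i) (Q j) \<longleftrightarrow> Tri a x z b y c \<in> carrier T \<and>
    (i = 1 \<and> j = 1 \<or> a = \<zero>\<^bsub>R1\<^esub>) \<and> (i = 1 \<and> j = 2 \<or> x = \<zero>\<^bsub>M12\<^esub>) \<and>
    (i = 1 \<and> j = 3 \<or> z = \<zero>\<^bsub>M13\<^esub>) \<and> (i = 2 \<and> j = 2 \<or> b = \<zero>\<^bsub>R2\<^esub>) \<and>
    (i = 2 \<and> j = 3 \<or> y = \<zero>\<^bsub>M23\<^esub>) \<and> (i = 3 \<and> j = 3 \<or> c = \<zero>\<^bsub>R3\<^esub>)"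
  unfolding peirce_def using Q_entry[OF assms, of a x z b y c] by (auto split: if_splits)

text \<open>Multiplication of blocks is the bimodule action, so this is faithfulness of the bimodules.  The right-hand version
is the same with the other action.\<close>

lemma tri_faithful_left:
  assumes "i \<in> {1, 2, 3}" "j \<in> {1, 2, 3}" "i < j" and A: "A \<in> peirce T (Q i) (Q i)"
    and zero: "\<And>m. m \<in> peirce T (Q i) (Q j) \<Longrightarrow> A \<otimes>\<^bsub>T\<^esub> m = \<zero>\<^bsub>T\<^esub>"
  shows "A = \<zero>\<^bsub>T\<^esub>"
proof -
  obtain a x z b y c where A_eq: "A = Tri a x z b y c" by (cases A)
  consider "i = 1" "j = 2" | "i = 1" "j = 3" | "i = 2" "j = 3" using assms(1-3) by auto
  then show ?thesis
  proof cases
    case 1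
    have "lact M12 a m = \<zero>\<^bsub>M12\<^esub>" if "m \<in> carrier M12" for m
      using zero[of "Tri \<zero>\<^bsub>R1\<^esub> m \<zero>\<^bsub>M13\<^esub> \<zero>\<^bsub>R2\<^esub> \<zero>\<^bsub>M23\<^esub> \<zero>\<^bsub>R3\<^esub>"] A that
      by (simp add: 1 A_eq Q_peirce[simplified] tri_simps)
    then show ?thesis
      using faithful12(1) A by (simp add: 1 A_eq Q_peirce[simplified] tri_simps left_faithful_def)
  next
    case 2
    have "lact M13 a m = \<zero>\<^bsub>M13\<^esub>" if "m \<in> carrier M13" for m
      using zero[of "Tri \<zero>\<^bsub>R1\<^esub> \<zero>\<^bsub>M12\<^esub> m \<zero>\<^bsub>R2\<^esub> \<zero>\<^bsub>M23\<^esub> \<zero>\<^bsub>R3\<^esub>"] A that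
      by (simp add: 2 A_eq Q_peirce[simplified] tri_simps)
    then show ?thesis
      using faithful13(1) A by (simp add: 2 A_eq Q_peirce[simplified] tri_simps left_faithful_def)
  next
    case 3
    have "lact M23 b m = \<zero>\<^bsub>M23\<^esub>" if "m \<in> carrier M23" for m
      using zero[of "Tri \<zero>\<^bsub>R1\<^esub> \<zero>\<^bsub>M12\<^esub> \<zero>\<^bsub>M13\<^esub> \<zero>\<^bsub>R2\<^esub> m \<zero>\<^bsub>R3\<^esub>"] A that
      by (simp add: 3 A_eq Q_peirce[simplified] tri_simps)
    then show ?thesis
      using faithful23(1) A by (simp add: 3 A_eq Q_peirce[simplified] tri_simps left_faithful_def)
  qed
qed

lemma tri_faithful_right:
  assumes "i \<in> {1, 2, 3}" "j \<in> {1, 2, 3}" "i < j" and A: "A \<in> peirce T (Q j) (Q j)"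
    and zero: "\<And>m. m \<in> peirce T (Q i) (Q j) \<Longrightarrow> m \<otimes>\<^bsub>T\<^esub> A = \<zero>\<^bsub>T\<^esub>"
  shows "A = \<zero>\<^bsub>T\<^esub>"
proof -
  obtain a x z b y c where A_eq: "A = Tri a x z b y c" by (cases A)
  consider "i = 1" "j = 2" | "i = 1" "j = 3" | "i = 2" "j = 3" using assms(1-3) by auto
  then show ?thesis
  proof cases
    case 1
    have "ract M12 m b = \<zero>\<^bsub>M12\<^esub>" if "m \<in> carrier M12" for m
      using zero[of "Tri \<zero>\<^bsub>R1\<^esub> m \<zero>\<^bsub>M13\<^esub> \<zero>\<^bsub>R2\<^esub> \<zero>\<^bsub>M23\<^esub> \<zero>\<^bsub>R3\<^esub>"] A that
      by (simp add: 1 A_eq Q_peirce[simplified] tri_simps)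
    then show ?thesis
      using faithful12(2) A by (simp add: 1 A_eq Q_peirce[simplified] tri_simps right_faithful_def)
  next
    case 2
    have "ract M13 m c = \<zero>\<^bsub>M13\<^esub>" if "m \<in> carrier M13" for m
      using zero[of "Tri \<zero>\<^bsub>R1\<^esub> \<zero>\<^bsub>M12\<^esub> m \<zero>\<^bsub>R2\<^esub> \<zero>\<^bsub>M23\<^esub> \<zero>\<^bsub>R3\<^esub>"] A that
      by (simp add: 2 A_eq Q_peirce[simplified] tri_simps)
    then show ?thesis
      using faithful13(2) A by (simp add: 2 A_eq Q_peirce[simplified] tri_simps right_faithful_def)
  next
    case 3
    have "ract M23 m c = \<zero>\<^bsub>M23\<^esub>" if "m \<in> carrier M23" for m
      using zero[of "Tri \<zero>\<^bsub>R1\<^esub> \<zero>\<^bsub>M12\<^esub> \<zero>\<^bsub>M13\<^esub> \<zero>\<^bsub>R2\<^esub> m \<zero>\<^bsub>R3\<^esub>"] A that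
      by (simp add: 3 A_eq Q_peirce[simplified] tri_simps)
    then show ?thesis
      using faithful23(2) A by (simp add: 3 A_eq Q_peirce[simplified] tri_simps right_faithful_def)
  qed
qed

lemma tri_triangular_idempotents: "triangular_idempotents T {1, 2, 3 :: nat} Q"
proof -
  interpret T: ring T by (rule ring_tri_ring)
  have Q_closed: "Q i \<in> carrier T" for i
    by (simp add: tri_idem_def tri_simps)
  show ?thesis
  proof
    show "finite {1, 2, 3 :: nat}" by simp
    show "\<exists>j\<in>{1, 2, 3}. j \<noteq> i" if "i \<in> {1, 2, 3 :: nat}" for i using that by auto
    show "Q i \<in> carrier T" for i by (rule Q_closed)
    show "Q i \<otimes>\<^bsub>T\<^esub> Q j = (if i = j then Q i else \<zero>\<^bsub>T\<^esub>)" if "i \<in> {1, 2, 3}" "j \<in> {1, 2, 3}" for i j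
      using that by (auto simp: tri_idem_def tri_simps)
    have "(\<Oplus>\<^bsub>T\<^esub>i\<in>{1, 2, 3}. Q i) = Q 1 \<oplus>\<^bsub>T\<^esub> (Q 2 \<oplus>\<^bsub>T\<^esub> Q 3)"
      using Q_closed by (simp add: T.finsum_insert)
    also have "\<dots> = \<one>\<^bsub>T\<^esub>"
      by (simp add: tri_idem_def tri_simps)
    finally show "(\<Oplus>\<^bsub>T\<^esub>i\<in>{1, 2, 3}. Q i) = \<one>\<^bsub>T\<^esub>" .
    show "Q i \<otimes>\<^bsub>T\<^esub> A \<otimes>\<^bsub>T\<^esub> Q j = \<zero>\<^bsub>T\<^esub>"
      if ij: "i \<in> {1, 2, 3}" "j \<in> {1, 2, 3}" "j < i" and A: "A \<in> carrier T" for i j A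
    proof -
      obtain a x z b y c where A_eq: "A = Tri a x z b y c" by (cases A)
      show ?thesis
        using ij(3) unfolding A_eq Q_entry[OF ij(1,2) A[unfolded A_eq]] by (auto simp: tri_zero)
    qed
  qed (fact tri_faithful_left tri_faithful_right)+
qed

end

theorem theorem2p2:
  fixes R1 :: "'r1 ring" and R2 :: "'r2 ring" and R3 :: "'r3 ring"
    and M12 :: "('r1, 'r2, 'm12) bimodule"
    and M13 :: "('r1, 'r3, 'm13) bimodule"
    and M23 :: "('r2, 'r3, 'm23) bimodule"
    and f :: "('m12 \<times> 'm23 \<Rightarrow>\<^sub>0 int) set \<Rightarrow> 'm13"
    and T :: "('r1, 'r2, 'r3, 'm12, 'm13, 'm23) tri ring"
    and Q :: "nat \<Rightarrow> ('r1, 'r2, 'r3, 'm12, 'm13, 'm23) tri"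
    and \<phi> :: "('r1, 'r2, 'r3, 'm12, 'm13, 'm23) tri \<Rightarrow> ('r1, 'r2, 'r3, 'm12, 'm13, 'm23) tri"
  assumes "triangular3 R1 R2 R3 M12 M13 M23 f"
    and T_def: "T = tri_ring R1 R2 R3 M12 M13 M23 f"
    and Q_def: "Q = tri_idem R1 R2 R3 M12 M13 M23"
    and center: "\<And>i. i \<in> {1, 2, 3} \<Longrightarrow>
          (\<lambda>z. Q i \<otimes>\<^bsub>T\<^esub> z \<otimes>\<^bsub>T\<^esub> Q i) ` ring_center T = ring_center (corner_ring T (Q i))"
    and "mult_lie_derivation T \<phi>"
  shows "\<exists>\<delta> \<gamma>. ring_derivation T \<delta> \<and>
           \<gamma> \<in> carrier T \<rightarrow> ring_center T \<and>
           (\<forall>x \<in> carrier T. \<forall>y \<in> carrier T. \<gamma> (lie_bracket T x y) = \<zero>\<^bsub>T\<^esub>) \<and>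
           (\<forall>x \<in> carrier T. \<phi> x = \<delta> x \<oplus>\<^bsub>T\<^esub> \<gamma> x)"
proof -
  interpret triangular_idempotents T "{1, 2, 3 :: nat}" Q
    unfolding T_def Q_def using assms(1) by (rule triangular3.tri_triangular_idempotents)
  show ?thesis
  proof (rule mult_lie_derivation_decomposition[OF assms(5)])
    fix i c
    assume i: "i \<in> {1, 2, 3 :: nat}" and c: "c \<in> block i i"
      and comm: "\<And>a. a \<in> block i i \<Longrightarrow> c \<otimes>\<^bsub>T\<^esub> a = a \<otimes>\<^bsub>T\<^esub> c"
    have "c \<in> ring_center (corner_ring T (Q i))"
      using corner_center[OF ring_axioms e_closed[OF i] _ c comm] e_mult[OF i i] by simp
    then have "c \<in> entry i i ` ring_center T"
      by (simp only: center[OF i])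
    then show "\<exists>z\<in>ring_center T. entry i i z = c"
      by blast
  qed
qed

end
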